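(* Let $\mathbb K$ be a commutative ring with $1$, let $(\mathcal X,\rho,\mathcal C)$ be a semi-Cartan graph with $\mathcal X$ finite, let $\mathcal R$ be a generalized root system of it, $\mathcal W$ its Weyl groupoid and $\mathcal N$ its nil-Hecke algebra over $\mathbb K$. Let $x,y\in\mathcal X$ and let $w\in\mathcal W(y,x)$ have length $m$. If $w=\sigma_{i_1}^x\sigma_{i_2}\cdots\sigma_{i_m}=\sigma_{j_1}^x\sigma_{j_2}\cdots\sigma_{j_m}$ are two reduced expressions of $w$, then $$n_{i_1}^xn_{i_2}\cdots n_{i_m}=n_{j_1}^xn_{j_2}\cdots n_{j_m}\quad\text{in }\mathcal N.$$ Denote this element by $T_w$, and set $T_{\mathrm{id}_x}:=\mathrm e^x$ for all $x\in\mathcal X$. Then $$\{T_w\mid w\in\mathcal W(y,x),\ x,y\in\mathcal X\}$$ is a basis of $\mathcal N$ (as a $\mathbb K$-module, indexed by the morphisms of $\mathcal W$).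
   Context: Let $\theta\in\mathbb N$, $\mathbb I=\{1,\dots,\theta\}$, $\{\alpha_i\}_{i\in\mathbb I}$ the canonical basis of $\mathbb Z^{\mathbb I}$. A basic datum $(\mathcal X,\rho)$ is a non-empty set $\mathcal X$ with permutations $\rho_i$ of $\mathcal X$ ($i\in\mathbb I$) such that $\rho_i^2=\mathrm{id}$. A semi-Cartan graph $(\mathcal X,\rho,\mathcal C)$ is a basic datum with a family $\mathcal C=(C^x)_{x\in\mathcal X}$, $C^x=(c^x_{ij})_{i,j\in\mathbb I}$, of generalized Cartan matrices (integer matrices with $c^x_{ii}=2$, and for $i\ne j$: $c^x_{ij}\le 0$, and $c^x_{ij}=0\iff c^x_{ji}=0$) such that $c^x_{ij}=c^{\rho_i(x)}_{ij}$ for all $x,i,j$. Define $s_i^x\in GL_\theta(\mathbb Z)$ by $s_i^x(\alpha_j)=\alpha_j-c^x_{ij}\alpha_i$. A generalized root system $\mathcal R(\mathcal X,\rho,\mathcal C,\Delta)$ is a family $\Delta=(\Delta^x)_{x\in\mathcal X}$ of subsets $\Delta^x\subset\mathbb Z^{\mathbb I}$ such that for all $x\in\mathcal X$, $i\neq j\in\mathbb I$: $\Delta^x=\Delta^x_+\cup\Delta^x_-$ with $\Delta^x_\pm=\pm(\Delta^x\cap\mathbb N_0^{\mathbb I})$; $\Delta^x\cap\mathbb Z\alpha_i=\{\pm\alpha_i\}$; $s_i^x(\Delta^x)=\Delta^{\rho_i(x)}$; and, with $m_{ij}^x:=|\Delta^x\cap(\mathbb N_0\alpha_i+\mathbb N_0\alpha_j)|$,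 $(\rho_i\rho_j)^{m^x_{ij}}(x)=x$ whenever $m_{ij}^x<\infty$. Put $m_{ii}^x=1$. The Weyl groupoid $\mathcal W$ is the groupoid with object set $\mathcal X$ generated by arrows $\sigma_i^x$ ($x\in\mathcal X$, $i\in\mathbb I$) with source $\rho_i(x)$ and target $x$, subject to $(\sigma_i^x\sigma_j)^{m^x_{ij}}=\mathrm{id}_x$ for all $x$ and all $i,j\in\mathbb I$ with $m^x_{ij}<\infty$ (for $i=j$ this reads $\sigma_i^x\sigma_i^{\rho_i(x)}=\mathrm{id}_x$). A product $\sigma\tau$ is defined when the source of $\sigma$ is the target of $\tau$. Omitted superscripts are the unique ones making a product composable: $\sigma_{i_1}^x\sigma_{i_2}\cdots\sigma_{i_t}$ means $\sigma_{i_1}^{x}\sigma_{i_2}^{\rho_{i_1}(x)}\cdots\sigma_{i_t}^{\rho_{i_{t-1}}\cdots\rho_{i_1}(x)}$; the same convention is used for the symbols $n_i^x$ below. $\mathcal W(y,x)$ is the set of morphisms with source $y$ and target $x$. The length $\ell(w)$ of $w$ with target $x$ is the least $m$ such that $w=\sigma^x_{i_1}\cdots\sigma_{i_m}$ for some $i_1,\dots,i_m$ (identities have length $0$); an expression with $m=\ell(w)$ is reduced. The nil-Hecke algebra $\mathcal N=\mathcal N(\mathcal X,\rho,\mathcal C)$ is the unital associative $\mathbb K$-algebra generated by $\mathrm e^x$, $n_i^x$ ($x\in\mathcal X$, $i\in\mathbb I$) with relations, for all $x,y\in\mathcal X$ and $i\ne j\in\mathbb I$: $\mathrm e^x\mathrm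 e^y=\delta_{x,y}\mathrm e^x$; $\sum_{x\in\mathcal X}\mathrm e^x=1$; $n_i^x\mathrm e^{\rho_i(x)}=\mathrm e^xn_i^x=n_i^x$; $n_i^{\rho_i(x)}n_i^x=0$; and, when $m_{ij}^x<\infty$, $n_i^xn_jn_i\cdots=n_j^xn_in_j\cdots$ (alternating products with $m_{ij}^x$ factors on each side). *)

theory Defs
  imports
    "HOL-Analysis.Finite_Cartesian_Product"
    "HOL-Library.Extended_Nat"
    "HOL-Library.Poly_Mapping"
    "HOL-Algebra.QuotRing"
    "HOL-Algebra.Module"
begin

text \<open>
  The index set of rank \<open>\<theta>\<close> is a finite type \<open>'i\<close> (so \<open>\<theta> = CARD('i) \<ge> 1\<close>), the set of points is a
  type \<open>'x\<close>, and the lattice \<open>\<int>\<^sup>\<theta>\<close> is \<open>int ^ 'i\<close>.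
\<close>

section \<open>Semi-Cartan graphs and generalized root systems\<close>

definition basic_datum :: "('i \<Rightarrow> 'x \<Rightarrow> 'x) \<Rightarrow> bool" where
  "basic_datum \<rho> \<longleftrightarrow> (\<forall>i. bij (\<rho> i) \<and> \<rho> i \<circ> \<rho> i = id)"

definition generalized_Cartan_matrix :: "int ^ 'i ^ 'i::finite \<Rightarrow> bool" where
  "generalized_Cartan_matrix A \<longleftrightarrow>
     (\<forall>i. A $ i $ i = 2) \<and>
     (\<forall>i j. i \<noteq> j \<longrightarrow> A $ i $ j \<le> 0 \<and> (A $ i $ j = 0 \<longleftrightarrow> A $ j $ i = 0))"

definition semi_Cartan_graph ::
  "('i \<Rightarrow> 'x \<Rightarrow> 'x) \<Rightarrow> ('x \<Rightarrow> int ^ 'i ^ 'i::finite) \<Rightarrow> bool" where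
  "semi_Cartan_graph \<rho> C \<longleftrightarrow>
     basic_datum \<rho> \<and>
     (\<forall>x. generalized_Cartan_matrix (C x)) \<and>
     (\<forall>x i j. C x $ i $ j = C (\<rho> i x) $ i $ j)"

definition simple_root :: "'i::finite \<Rightarrow> int ^ 'i" where
  "simple_root i = axis i 1"

text \<open>The \<open>\<int>\<close>-linear map with \<open>s\<^sub>i\<^sup>x(\<alpha>\<^sub>j) = \<alpha>\<^sub>j - c\<^sub>i\<^sub>j\<^sup>x \<alpha>\<^sub>i\<close>.\<close>

definition simple_reflection ::
  "('x \<Rightarrow> int ^ 'i ^ 'i::finite) \<Rightarrow> 'i \<Rightarrow> 'x \<Rightarrow> int ^ 'i \<Rightarrow> int ^ 'i" where
  "simple_reflection C i x v =
     (\<Sum>j\<in>UNIV. (v $ j) *s (simple_root j - (C x $ i $ j) *s simple_root i))"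

definition positive_part :: "(int ^ 'i::finite) set \<Rightarrow> (int ^ 'i) set" where
  "positive_part D = D \<inter> {v. \<forall>i. 0 \<le> v $ i}"

definition rank_two_cone :: "'i::finite \<Rightarrow> 'i \<Rightarrow> (int ^ 'i) set" where
  "rank_two_cone i j =
     {int a *s simple_root i + int b *s simple_root j | a b :: nat. True}"

definition coxeter_number ::
  "('x \<Rightarrow> (int ^ 'i::finite) set) \<Rightarrow> 'x \<Rightarrow> 'i \<Rightarrow> 'i \<Rightarrow> enat" where
  "coxeter_number \<Delta> x i j =
     (if i = j then 1
      else if finite (\<Delta> x \<inter> rank_two_cone i j) then enat (card (\<Delta> x \<inter> rank_two_cone i j))
      else \<infinity>)"

definition generalized_root_system ::
  "('i \<Rightarrow> 'x \<Rightarrow> 'x) \<Rightarrow> ('x \<Rightarrow> int ^ 'i ^ 'i::finite) \<Rightarrow> ('x \<Rightarrow> (int ^ 'i) set) \<Rightarrow> bool" where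
  "generalized_root_system \<rho> C \<Delta> \<longleftrightarrow>
     (\<forall>x. \<Delta> x = positive_part (\<Delta> x) \<union> uminus ` positive_part (\<Delta> x)) \<and>
     (\<forall>x i. \<Delta> x \<inter> {k *s simple_root i | k :: int. True} = {simple_root i, - simple_root i}) \<and>
     (\<forall>x i. simple_reflection C i x ` \<Delta> x = \<Delta> (\<rho> i x)) \<and>
     (\<forall>x i j m. i \<noteq> j \<longrightarrow> coxeter_number \<Delta> x i j = enat m \<longrightarrow> ((\<rho> i \<circ> \<rho> j) ^^ m) x = x)"

section \<open>The Weyl groupoid\<close>

text \<open>
  A path in the free groupoid is a target \<open>x\<close> together with a word of letters, read from the target
  towards the source.  At target \<open>z\<close>, the letter \<open>Pos i\<close> is \<open>\<sigma>\<^sub>i\<^sup>z\<close>, and \<open>Neg i\<close> is the formal inverse of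
  the arrow \<open>\<sigma>\<^sub>i\<close> with superscript \<open>\<rho>\<^sub>i(z)\<close>; both have source \<open>\<rho>\<^sub>i(z)\<close>.
\<close>

datatype 'i letter = Pos (index: 'i) | Neg (index: 'i)

definition path_source :: "('i \<Rightarrow> 'x \<Rightarrow> 'x) \<Rightarrow> 'x \<Rightarrow> 'i list \<Rightarrow> 'x" where
  "path_source \<rho> x is = fold \<rho> is x"

text \<open>
  \<open>weyl_eq \<rho> \<Delta> x u v\<close>: the words \<open>u\<close> and \<open>v\<close> with common target \<open>x\<close> represent the same morphism of the
  Weyl groupoid.
\<close>

inductive weyl_eq ::
  "('i \<Rightarrow> 'x \<Rightarrow> 'x) \<Rightarrow> ('x \<Rightarrow> (int ^ 'i::finite) set) \<Rightarrow>
     'x \<Rightarrow> 'i letter list \<Rightarrow> 'i letter list \<Rightarrow> bool" for \<rho> \<Delta> where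
  weyl_refl: "weyl_eq \<rho> \<Delta> x u u"
| weyl_sym: "weyl_eq \<rho> \<Delta> x u v \<Longrightarrow> weyl_eq \<rho> \<Delta> x v u"
| weyl_trans: "weyl_eq \<rho> \<Delta> x u v \<Longrightarrow> weyl_eq \<rho> \<Delta> x v w \<Longrightarrow> weyl_eq \<rho> \<Delta> x u w"
| weyl_cong: "weyl_eq \<rho> \<Delta> (path_source \<rho> x (map index p)) u v \<Longrightarrow>
     weyl_eq \<rho> \<Delta> x (p @ u @ q) (p @ v @ q)"
| weyl_right_inv: "weyl_eq \<rho> \<Delta> x [Pos i, Neg i] []"
| weyl_left_inv: "weyl_eq \<rho> \<Delta> x [Neg i, Pos i] []"
| weyl_coxeter: "coxeter_number \<Delta> x i j = enat m \<Longrightarrow>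
     weyl_eq \<rho> \<Delta> x (concat (replicate m [Pos i, Pos j])) []"

definition weyl_rel ::
  "('i \<Rightarrow> 'x \<Rightarrow> 'x) \<Rightarrow> ('x \<Rightarrow> (int ^ 'i::finite) set) \<Rightarrow> ('x \<times> 'i letter list) rel" where
  "weyl_rel \<rho> \<Delta> = {((x, u), (x, v)) | x u v. weyl_eq \<rho> \<Delta> x u v}"

type_synonym ('x, 'i) weyl_morphism = "('x \<times> 'i letter list) set"

text \<open>\<open>weyl_hom \<rho> \<Delta> y x\<close> is \<open>\<W>(y, x)\<close>: source \<open>y\<close>, target \<open>x\<close>.\<close>

definition weyl_hom ::
  "('i \<Rightarrow> 'x \<Rightarrow> 'x) \<Rightarrow> ('x \<Rightarrow> (int ^ 'i::finite) set) \<Rightarrow> 'x \<Rightarrow> 'x \<Rightarrow> ('x, 'i) weyl_morphism set" where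
  "weyl_hom \<rho> \<Delta> y x =
     {(x, u) | u. path_source \<rho> x (map index u) = y} // weyl_rel \<rho> \<Delta>"

definition weyl_morphisms ::
  "('i \<Rightarrow> 'x \<Rightarrow> 'x) \<Rightarrow> ('x \<Rightarrow> (int ^ 'i::finite) set) \<Rightarrow> ('x, 'i) weyl_morphism set" where
  "weyl_morphisms \<rho> \<Delta> = (\<Union>x y. weyl_hom \<rho> \<Delta> y x)"

text \<open>
  Composition is concatenation of words, so the product \<open>\<sigma>\<close> of the arrows with indices \<open>i\<^sub>1, \<dots>, i\<^sub>t\<close> and
  target \<open>x\<close> is the class of the corresponding positive word (the identity at \<open>x\<close> if \<open>t = 0\<close>).
\<close>

definition sigma_prod ::
  "('i \<Rightarrow> 'x \<Rightarrow> 'x) \<Rightarrow> ('x \<Rightarrow> (int ^ 'i::finite) set) \<Rightarrow> 'x \<Rightarrow> 'i list \<Rightarrow> ('x, 'i) weyl_morphism" where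
  "sigma_prod \<rho> \<Delta> x is = weyl_rel \<rho> \<Delta> `` {(x, map Pos is)}"

definition weyl_length ::
  "('i \<Rightarrow> 'x \<Rightarrow> 'x) \<Rightarrow> ('x \<Rightarrow> (int ^ 'i::finite) set) \<Rightarrow> ('x, 'i) weyl_morphism \<Rightarrow> nat" where
  "weyl_length \<rho> \<Delta> w = (LEAST m. \<exists>x is. length is = m \<and> w = sigma_prod \<rho> \<Delta> x is)"

definition reduced_expression ::
  "('i \<Rightarrow> 'x \<Rightarrow> 'x) \<Rightarrow> ('x \<Rightarrow> (int ^ 'i::finite) set) \<Rightarrow>
     'x \<Rightarrow> 'i list \<Rightarrow> ('x, 'i) weyl_morphism \<Rightarrow> bool" where
  "reduced_expression \<rho> \<Delta> x is w \<longleftrightarrow>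
     w = sigma_prod \<rho> \<Delta> x is \<and> length is = weyl_length \<rho> \<Delta> w"

section \<open>The nil-Hecke algebra\<close>

text \<open>
  The free monoid on \<open>'g\<close>, written additively because \<^type>\<open>poly_mapping\<close> expects the exponents of a
  monoid algebra to form an additive monoid; \<open>'g fmon \<Rightarrow>\<^sub>0 'k\<close> is then the free associative
  \<open>'k\<close>-algebra on \<open>'g\<close>.
\<close>

datatype 'g fmon = FMon (fmon_list: "'g list")

instantiation fmon :: (type) monoid_add
begin

definition zero_fmon :: "'a fmon" where
  "0 = FMon []"

definition plus_fmon :: "'a fmon \<Rightarrow> 'a fmon \<Rightarrow> 'a fmon" where
  "u + v = FMon (fmon_list u @ fmon_list v)"

instance
  by standard (simp_all add: zero_fmon_def plus_fmon_def)

end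

datatype ('x, 'i) nil_gen = Gen_e 'x | Gen_n 'x 'i

type_synonym ('x, 'i, 'k) nil_free = "('x, 'i) nil_gen fmon \<Rightarrow>\<^sub>0 'k"

text \<open>
  The sort \<open>{comm_ring, comm_monoid_mult}\<close> describes the commutative rings with \<open>1\<close>, the zero ring
  included; it is \<^class>\<open>comm_ring_1\<close> without the axiom \<open>0 \<noteq> 1\<close>.  As \<open>1\<close> is not available in
  \<^type>\<open>poly_mapping\<close> at this generality, constants are written \<open>free_const a\<close>.
\<close>

definition free_const :: "'k::{comm_ring, comm_monoid_mult} \<Rightarrow> ('x, 'i, 'k) nil_free" where
  "free_const a = Poly_Mapping.single 0 a"

definition free_e :: "'x \<Rightarrow> ('x, 'i, 'k::{comm_ring, comm_monoid_mult}) nil_free" where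
  "free_e x = Poly_Mapping.single (FMon [Gen_e x]) 1"

definition free_n :: "'x \<Rightarrow> 'i \<Rightarrow> ('x, 'i, 'k::{comm_ring, comm_monoid_mult}) nil_free" where
  "free_n x i = Poly_Mapping.single (FMon [Gen_n x i]) 1"

primrec free_n_prod ::
  "('i \<Rightarrow> 'x \<Rightarrow> 'x) \<Rightarrow> 'x \<Rightarrow> 'i list \<Rightarrow> ('x, 'i, 'k::{comm_ring, comm_monoid_mult}) nil_free" where
  "free_n_prod \<rho> x [] = free_const 1"
| "free_n_prod \<rho> x (i # is) = free_n x i * free_n_prod \<rho> (\<rho> i x) is"

definition alternating :: "'i \<Rightarrow> 'i \<Rightarrow> nat \<Rightarrow> 'i list" where
  "alternating i j m = map (\<lambda>k. if even k then i else j) [0..<m]"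

definition nil_relations ::
  "('i \<Rightarrow> 'x \<Rightarrow> 'x) \<Rightarrow> ('x \<Rightarrow> (int ^ 'i::finite) set) \<Rightarrow>
     ('x::finite, 'i, 'k::{comm_ring, comm_monoid_mult}) nil_free set" where
  "nil_relations \<rho> \<Delta> =
     {free_e x * free_e y - (if x = y then free_e x else 0) | x y. True} \<union>
     {(\<Sum>x\<in>UNIV. free_e x) - free_const 1} \<union>
     {free_n x i * free_e (\<rho> i x) - free_n x i | x i. True} \<union>
     {free_e x * free_n x i - free_n x i | x i. True} \<union>
     {free_n (\<rho> i x) i * free_n x i | x i. True} \<union>
     {free_n_prod \<rho> x (alternating i j m) - free_n_prod \<rho> x (alternating j i m) | x i j m.
        i \<noteq> j \<and> coxeter_number \<Delta> x i j = enat m}"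

definition free_algebra :: "('x, 'i, 'k::{comm_ring, comm_monoid_mult}) nil_free ring" where
  "free_algebra =
     \<lparr>carrier = UNIV, monoid.mult = (*), one = free_const 1, ring.zero = 0, add = (+)\<rparr>"

definition nil_ideal ::
  "('i \<Rightarrow> 'x \<Rightarrow> 'x) \<Rightarrow> ('x \<Rightarrow> (int ^ 'i::finite) set) \<Rightarrow>
     ('x::finite, 'i, 'k::{comm_ring, comm_monoid_mult}) nil_free set" where
  "nil_ideal \<rho> \<Delta> = Idl\<^bsub>free_algebra\<^esub> (nil_relations \<rho> \<Delta>)"

definition nil_coset ::
  "('i \<Rightarrow> 'x \<Rightarrow> 'x) \<Rightarrow> ('x \<Rightarrow> (int ^ 'i::finite) set) \<Rightarrow>
     ('x::finite, 'i, 'k::{comm_ring, comm_monoid_mult}) nil_free \<Rightarrow> ('x, 'i, 'k) nil_free set" where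
  "nil_coset \<rho> \<Delta> f = nil_ideal \<rho> \<Delta> +>\<^bsub>free_algebra\<^esub> f"

text \<open>
  The quotient of the free algebra by the two-sided ideal of relations.  A scalar \<open>a\<close> acts as
  multiplication by the class of the constant \<open>a\<close> of the free algebra.
\<close>

definition nil_Hecke ::
  "('i \<Rightarrow> 'x \<Rightarrow> 'x) \<Rightarrow> ('x \<Rightarrow> (int ^ 'i::finite) set) \<Rightarrow>
     ('k::{comm_ring, comm_monoid_mult}, ('x::finite, 'i, 'k) nil_free set) module" where
  "nil_Hecke \<rho> \<Delta> =
     (let Q = free_algebra Quot nil_ideal \<rho> \<Delta> in
      \<lparr>carrier = carrier Q, monoid.mult = mult Q, one = one Q, ring.zero = zero Q, add = add Q,
       smult = (\<lambda>a U. nil_coset \<rho> \<Delta> (free_const a) \<otimes>\<^bsub>Q\<^esub> U)\<rparr>)"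

definition nil_e ::
  "('i \<Rightarrow> 'x \<Rightarrow> 'x) \<Rightarrow> ('x \<Rightarrow> (int ^ 'i::finite) set) \<Rightarrow>
     'x \<Rightarrow> ('x::finite, 'i, 'k::{comm_ring, comm_monoid_mult}) nil_free set" where
  "nil_e \<rho> \<Delta> x = nil_coset \<rho> \<Delta> (free_e x)"

definition nil_n ::
  "('i \<Rightarrow> 'x \<Rightarrow> 'x) \<Rightarrow> ('x \<Rightarrow> (int ^ 'i::finite) set) \<Rightarrow>
     'x \<Rightarrow> 'i \<Rightarrow> ('x::finite, 'i, 'k::{comm_ring, comm_monoid_mult}) nil_free set" where
  "nil_n \<rho> \<Delta> x i = nil_coset \<rho> \<Delta> (free_n x i)"

primrec nil_prod ::
  "('i \<Rightarrow> 'x \<Rightarrow> 'x) \<Rightarrow> ('x \<Rightarrow> (int ^ 'i::finite) set) \<Rightarrow>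
     'x \<Rightarrow> 'i list \<Rightarrow> ('x::finite, 'i, 'k::{comm_ring, comm_monoid_mult}) nil_free set" where
  "nil_prod \<rho> \<Delta> x [] = \<one>\<^bsub>nil_Hecke \<rho> \<Delta>\<^esub>"
| "nil_prod \<rho> \<Delta> x (i # is) = nil_n \<rho> \<Delta> x i \<otimes>\<^bsub>nil_Hecke \<rho> \<Delta>\<^esub> nil_prod \<rho> \<Delta> (\<rho> i x) is"

text \<open>
  \<open>T\<^sub>w\<close> is the common value of the products over all reduced expressions of \<open>w\<close>.  The identity at \<open>x\<close>,
  whose only reduced expression is empty, is sent to \<open>e\<^sup>x\<close> and not to the empty product \<open>1\<close>.
\<close>

definition nil_T ::
  "('i \<Rightarrow> 'x \<Rightarrow> 'x) \<Rightarrow> ('x \<Rightarrow> (int ^ 'i::finite) set) \<Rightarrow>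
     ('x, 'i) weyl_morphism \<Rightarrow> ('x::finite, 'i, 'k::{comm_ring, comm_monoid_mult}) nil_free set" where
  "nil_T \<rho> \<Delta> w =
     (THE t. \<exists>x is. reduced_expression \<rho> \<Delta> x is w \<and>
        t = (if is = [] then nil_e \<rho> \<Delta> x else nil_prod \<rho> \<Delta> x is))"

section \<open>Bases of modules\<close>

text \<open>\<open>(b w)\<close> for \<open>w \<in> W\<close> is a basis, as an indexed family: it generates and is linearly independent.\<close>

definition family_combination ::
  "('k::zero, 'v, 'm) module_scheme \<Rightarrow> ('w \<Rightarrow> 'v) \<Rightarrow> ('w \<Rightarrow>\<^sub>0 'k) \<Rightarrow> 'v" where
  "family_combination M b a =
     (\<Oplus>\<^bsub>M\<^esub>w\<in>Poly_Mapping.keys a. Poly_Mapping.lookup a w \<odot>\<^bsub>M\<^esub> b w)"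

definition family_basis ::
  "('k::zero, 'v, 'm) module_scheme \<Rightarrow> 'w set \<Rightarrow> ('w \<Rightarrow> 'v) \<Rightarrow> bool" where
  "family_basis M W b \<longleftrightarrow>
     b ` W \<subseteq> carrier M \<and>
     (\<forall>v\<in>carrier M. \<exists>a. Poly_Mapping.keys a \<subseteq> W \<and> v = family_combination M b a) \<and>
     (\<forall>a. Poly_Mapping.keys a \<subseteq> W \<longrightarrow> family_combination M b a = \<zero>\<^bsub>M\<^esub> \<longrightarrow> a = 0)"

end

theory Submission
  imports Defs
begin

text \<open>
  The proof is the one for Iwahori--Hecke algebras of Coxeter groups, with lengths replaced by signs of
  roots.  Call a word reduced if every letter \<open>k\<close> is appended to a prefix mapping \<open>\<alpha>\<^sub>k\<close> to a positive
  root.  Counting positive roots made negative inside a rank two subsystem shows that the two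
  alternating words of length \<open>m\<^sub>i\<^sub>j\<close> are reduced and act by the same map, and that an alternating word
  which makes both simple roots negative has length \<open>m\<^sub>i\<^sub>j\<close>.  This yields the exchange property up to
  braid moves: a reduced word making \<open>\<alpha>\<^sub>j\<close> negative can be moved to one that ends in \<open>j\<close>.  Hence
  reduced words with the same action are related by braid moves, which hold in the nil-Hecke algebra,
  while every non-reduced word can be moved to one containing a square \<open>k k\<close> and so vanishes; this gives
  that \<open>T\<^sub>w\<close> is well defined and that these elements span.  For linear independence, the algebra acts
  on functions of pairs (point, linear map), a generator \<open>n\<^sub>i\<close> acting by composition with \<open>s\<^sub>i\<close> when
  this increases the length and by zero otherwise; the \<open>T\<^sub>w\<close> are told apart by their action.
\<close>

abbreviation src :: "('i \<Rightarrow> 'x \<Rightarrow> 'x) \<Rightarrow> 'x \<Rightarrow> 'i list \<Rightarrow> 'x" where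
  "src \<equiv> path_source"

lemma src_simps [simp]:
  "path_source \<rho> x [] = x"
  "path_source \<rho> x (i # u) = path_source \<rho> (\<rho> i x) u"
  "path_source \<rho> x (u @ v) = path_source \<rho> (path_source \<rho> x u) v"
  by (simp_all add: path_source_def)

section \<open>Integral linear maps and simple reflections\<close>

definition nonneg :: "int ^ 'i \<Rightarrow> bool" where
  "nonneg v \<longleftrightarrow> (\<forall>k. 0 \<le> v $ k)"

definition int_linear :: "(int ^ 'i::finite \<Rightarrow> int ^ 'i) \<Rightarrow> bool" where
  "int_linear f \<longleftrightarrow> (\<forall>a b u v. f (a *s u + b *s v) = a *s f u + b *s f v)"

lemma int_linearD: "int_linear f \<Longrightarrow> f (a *s u + b *s v) = a *s f u + b *s f v"
  by (simp add: int_linear_def)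

lemma int_linear_neg_comb: "int_linear f \<Longrightarrow> - f (a *s u + b *s v) = a *s (- f u) + b *s (- f v)"
  by (simp add: int_linearD vec_eq_iff)

lemma int_linear_uminus: "int_linear f \<Longrightarrow> f (- v) = - f v"
proof -
  have "- 1 *s w + 0 *s w = - w" for w :: "int ^ 'a" by (simp add: vec_eq_iff)
  then show "int_linear f \<Longrightarrow> f (- v) = - f v" by (metis int_linearD)
qed

lemma int_linear_diff: "int_linear f \<Longrightarrow> f (u - a *s v) = f u - a *s f v"
proof -
  have "1 *s t + (- a) *s w = t - a *s w" for t w :: "int ^ 'a" by (simp add: vec_eq_iff)
  then show "int_linear f \<Longrightarrow> f (u - a *s v) = f u - a *s f v" by (metis int_linearD)
qed

lemma int_linear_add: "int_linear f \<Longrightarrow> f (u + v) = f u + f v"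
  using int_linearD[of f 1 u 1 v] by (simp add: vec_eq_iff)

lemma int_linear_comp: "int_linear f \<Longrightarrow> int_linear g \<Longrightarrow> int_linear (f \<circ> g)"
  by (simp add: int_linear_def)

lemma nonneg_zero: "nonneg v \<Longrightarrow> nonneg (- v) \<Longrightarrow> v = 0"
  by (simp add: nonneg_def vec_eq_iff eq_iff)

lemma nonneg_comb: "nonneg u \<Longrightarrow> nonneg v \<Longrightarrow> 0 \<le> a \<Longrightarrow> 0 \<le> b \<Longrightarrow> nonneg (a *s u + b *s v)"
  by (simp add: nonneg_def)

lemma simple_root_nth [simp]: "simple_root i $ k = (if k = i then 1 else 0)"
  by (simp add: simple_root_def axis_def)

lemma simple_root_eq_iff [simp]: "simple_root i = simple_root j \<longleftrightarrow> i = j"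
  by (metis simple_root_nth zero_neq_one)

lemma nonneg_simple_root [simp]: "nonneg (simple_root i)"
  by (simp add: nonneg_def)

lemma not_nonneg_minus_simple_root [simp]: "\<not> nonneg (- simple_root i)"
  by (auto simp: nonneg_def intro!: exI[of _ i])

lemma simple_reflection_nth:
  "simple_reflection C i x v $ k = v $ k - (if k = i then \<Sum>j\<in>UNIV. C x $ i $ j * v $ j else 0)"
proof -
  have "simple_reflection C i x v $ k
      = (\<Sum>j\<in>UNIV. (if k = j then v $ j else 0) - (if k = i then C x $ i $ j * v $ j else 0))"
    unfolding simple_reflection_def sum_component by (rule sum.cong) (auto simp: algebra_simps)
  then show ?thesis by (simp add: sum_subtractf)
qed

text \<open>Source of the positivity arguments: a nonzero coordinate outside \<open>i\<close>
  survives the reflection and so fixes the sign of the image root.\<close>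

lemma simple_reflection_off: "k \<noteq> i \<Longrightarrow> simple_reflection C i x v $ k = v $ k"
  by (simp add: simple_reflection_nth)

lemma int_linear_reflection: "int_linear (simple_reflection C i x)"
  by (simp add: int_linear_def vec_eq_iff simple_reflection_nth sum.distrib sum_distrib_left algebra_simps)

lemma reflection_simple_root:
  "simple_reflection C i x (simple_root j) = simple_root j - C x $ i $ j *s simple_root i"
  by (auto simp: vec_eq_iff simple_reflection_nth if_distrib[of "\<lambda>t. _ * t"] cong: if_cong)

lemma linear_simple_ext:
  fixes f g :: "int ^ 'i::finite \<Rightarrow> int ^ 'i"
  assumes "int_linear f" "int_linear g" "\<And>k. f (simple_root k) = g (simple_root k)"
  shows "f = g"
proof
  fix v :: "int ^ 'i"
  have sum: "h (\<Sum>k\<in>A. (v $ k) *s simple_root k) = (\<Sum>k\<in>A. (v $ k) *s h (simple_root k))"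
    if h: "int_linear h" for h and A :: "'i set"
  proof (induction A rule: infinite_finite_induct)
    case (insert k A)
    then show ?case
      using int_linearD[OF h, of "v $ k" "simple_root k" 1] by simp
  \<comment> \<open>Empty and infinite sums are 0, and \<open>h\<close> maps 0 to 0 by linearity
    with all coefficients 0.\<close>
  qed (use int_linearD[OF h, of 0 0 0 0] in simp_all)
  have "v = (\<Sum>k\<in>UNIV. (v $ k) *s simple_root k)"
    by (simp add: vec_eq_iff sum_component if_distrib[of "\<lambda>t. _ * t"] cong: if_cong)
  then show "f v = g v" using sum[OF assms(1), of UNIV] sum[OF assms(2), of UNIV] assms(3) by simp
qed

section \<open>Alternating words\<close>

lemma alternating_0 [simp]: "alternating i j 0 = []"
  by (simp add: alternating_def)

lemma alternating_Suc: "alternating i j (Suc n) = alternating i j n @ [if even n then i else j]"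
  by (simp add: alternating_def)

lemma alternating_Cons: "alternating i j (Suc n) = i # alternating j i n"
proof -
  have "[0..<Suc n] = 0 # map Suc [0..<n]"
    by (simp add: map_Suc_upt upt_conv_Cons del: upt_Suc)
  then show ?thesis by (auto simp: alternating_def simp del: upt_Suc)
qed

lemma length_alternating [simp]: "length (alternating i j n) = n"
  by (simp add: alternating_def)

lemma set_alternating: "set (alternating i j n) \<subseteq> {i, j}"
  by (auto simp: alternating_def)

text \<open>Together the two parts turn the Coxeter relation for \<open>i\<close> and
  \<open>j\<close> into an equality of the two alternating words of half the length. For the first
  part, a letter is peeled off at either end, which exchanges \<open>i\<close> and
  \<open>j\<close>.\<close>

lemma alternating_double:
  "alternating i j (2 * n) = alternating i j n @ rev (alternating j i n)"
  "concat (replicate n [i, j]) = alternating i j (2 * n)"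
proof (induction n arbitrary: i j)
  case (Suc n)
  { case 1
    have "alternating i j (2 * Suc n) = i # alternating j i (2 * n) @ [j]"
      using alternating_Cons[of j i "2 * n"] alternating_Suc[of j i "2 * n"]
      by (simp add: alternating_Cons)
    then show ?case
      by (simp only: Suc(1)[of j i] alternating_Cons[of i j n] alternating_Cons[of j i n]
          append_Cons append_assoc rev.simps) }
  { case 2 then show ?case using Suc(2)[of i j] by (simp add: alternating_Cons) }
qed simp_all

section \<open>Signs of roots under simple reflections\<close>

locale root_system =
  fixes \<rho> :: "'i::finite \<Rightarrow> 'x \<Rightarrow> 'x"
    and C :: "'x \<Rightarrow> int ^ 'i ^ 'i"
    and \<Delta> :: "'x \<Rightarrow> (int ^ 'i) set"
  assumes graph: "semi_Cartan_graph \<rho> C"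
    and roots: "generalized_root_system \<rho> C \<Delta>"
begin

lemma rho_rho [simp]: "\<rho> i (\<rho> i x) = x"
  using graph unfolding semi_Cartan_graph_def basic_datum_def by (metis comp_apply id_apply)

lemma C_diag [simp]: "C x $ i $ i = 2"
  using graph by (simp add: semi_Cartan_graph_def generalized_Cartan_matrix_def)

lemma C_rho [simp]: "C (\<rho> i x) $ i $ j = C x $ i $ j"
  using graph by (simp add: semi_Cartan_graph_def)

abbreviation "s \<equiv> simple_reflection C"

lemma s_rho [simp]: "s i (\<rho> i x) = s i x"
  by (rule ext) (simp add: vec_eq_iff simple_reflection_nth)

lemma s_simple [simp]: "s i x (simple_root i) = - simple_root i"
  by (simp add: reflection_simple_root vec_eq_iff)

lemma s_eq: "s i x v = v - (\<Sum>j\<in>UNIV. C x $ i $ j * v $ j) *s simple_root i"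
  by (simp add: vec_eq_iff simple_reflection_nth)

lemma s_s [simp]: "s i x (s i x v) = v"
proof -
  define c where "c = (\<Sum>j\<in>UNIV. C x $ i $ j * v $ j)"
  have v: "s i x v = v - c *s simple_root i" unfolding c_def by (rule s_eq)
  have "s i x (s i x v) = s i x v - c *s s i x (simple_root i)"
    using int_linear_diff[OF int_linear_reflection, of C i x v c "simple_root i"] by (simp only: v[symmetric])
  then show ?thesis unfolding v s_simple by (simp add: vec_eq_iff)
qed

lemma root_decomp: "\<Delta> x = positive_part (\<Delta> x) \<union> uminus ` positive_part (\<Delta> x)"
  using roots by (simp add: generalized_root_system_def)

lemma root_cases:
  assumes "v \<in> \<Delta> x" shows "nonneg v \<or> nonneg (- v)"
proof -
  have "v \<in> positive_part (\<Delta> x) \<or> - v \<in> positive_part (\<Delta> x)"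
    using assms by (subst (asm) root_decomp) auto
  then show ?thesis by (auto simp: positive_part_def nonneg_def)
qed

lemma root_uminus:
  assumes "v \<in> \<Delta> x" shows "- v \<in> \<Delta> x"
proof -
  have "v \<in> positive_part (\<Delta> x) \<or> - v \<in> positive_part (\<Delta> x)"
    using assms by (subst (asm) root_decomp) auto
  then show ?thesis by (subst root_decomp) auto
qed

lemma multiple_root: "\<Delta> x \<inter> {k *s simple_root i | k :: int. True} = {simple_root i, - simple_root i}"
  using roots by (simp add: generalized_root_system_def)

lemma simple_root_in [simp]: "simple_root i \<in> \<Delta> x"
  using multiple_root[of x i] by blast

lemma root_nonzero: "v \<in> \<Delta> x \<Longrightarrow> v \<noteq> 0"
proof
  assume "v \<in> \<Delta> x" "v = 0"
  \<comment> \<open>0 is the zero multiple of any simple root, and \<open>undefined\<close> is just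
    some index; the only multiples allowed as roots are the simple root and its negative.\<close>
  then have "0 \<in> \<Delta> x \<inter> {k *s simple_root undefined | k :: int. True}"
    by (auto intro!: exI[of _ 0])
  then have "0 \<in> {simple_root undefined, - simple_root undefined :: int ^ 'i}"
    unfolding multiple_root .
  then show False
    by (auto simp: vec_eq_iff dest: spec[of _ undefined])
qed

lemma root_not_both: "v \<in> \<Delta> x \<Longrightarrow> nonneg (- v) \<longleftrightarrow> \<not> nonneg v"
  using root_cases root_nonzero nonneg_zero by blast

lemma s_root: "v \<in> \<Delta> x \<Longrightarrow> s i x v \<in> \<Delta> (\<rho> i x)"
  using roots unfolding generalized_root_system_def by blast

lemma simple_multiple_root:
  assumes "v \<in> \<Delta> x" "nonneg v" "\<And>k. k \<noteq> i \<Longrightarrow> v $ k = 0"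
  shows "v = simple_root i"
proof -
  have "v = (v $ i) *s simple_root i" using assms(3) by (auto simp: vec_eq_iff)
  then have "v \<in> \<Delta> x \<inter> {k *s simple_root i | k :: int. True}" using assms(1) by blast
  then show ?thesis unfolding multiple_root using assms(2) by auto
qed

text \<open>Such a root has a positive coordinate outside \<open>i\<close>. The reflection leaves it
  unchanged, and a root has only one sign.\<close>

lemma s_nonneg:
  assumes "v \<in> \<Delta> x" "nonneg v" "v \<noteq> simple_root i"
  shows "nonneg (s i x v)"
proof -
  obtain k where k: "k \<noteq> i" "v $ k \<noteq> 0" using simple_multiple_root assms by blast
  then have "0 < s i x v $ k"
    using assms(2) by (simp add: simple_reflection_off nonneg_def order_less_le)
  then have "\<not> nonneg (- s i x v)" by (auto simp: nonneg_def not_le intro!: exI[of _ k])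
  then show ?thesis using root_cases[OF s_root[OF assms(1)]] by blast
qed

section \<open>Words\<close>

text \<open>Composition runs from the target: the result maps the lattice at the source of the word
  to the lattice at \<open>x\<close>.\<close>

primrec act :: "'x \<Rightarrow> 'i list \<Rightarrow> int ^ 'i \<Rightarrow> int ^ 'i" where
  "act x [] = id"
| "act x (i # u) = s i x \<circ> act (\<rho> i x) u"

lemma act_append: "act x (u @ v) = act x u \<circ> act (src \<rho> x u) v"
  by (induction u arbitrary: x) (simp_all add: comp_assoc)

lemma act_snoc: "act x (u @ [k]) = act x u \<circ> s k (src \<rho> x u)"
  by (simp only: act_append act.simps comp_id)

lemma int_linear_act: "int_linear (act x u)"
  by (induction u arbitrary: x)
     (auto intro: int_linear_comp int_linear_reflection simp: int_linear_def[of id])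

lemma act_root: "v \<in> \<Delta> (src \<rho> x u) \<Longrightarrow> act x u v \<in> \<Delta> x"
proof (induction u arbitrary: x)
  case (Cons i u)
  then have "act (\<rho> i x) u v \<in> \<Delta> (\<rho> i x)" by simp
  from s_root[OF this, of i] show ?case by simp
qed simp

lemma src_rev: "src \<rho> (src \<rho> x u) (rev u) = x"
  by (induction u arbitrary: x) simp_all

lemma act_rev: "act x u (act (src \<rho> x u) (rev u) v) = v"
proof (induction u arbitrary: x v)
  case (Cons i u)
  have "act x (i # u) (act (src \<rho> x (i # u)) (rev (i # u)) v)
      = s i x (act (\<rho> i x) u (act (src \<rho> (\<rho> i x) u) (rev u) (s i (\<rho> i x) v)))"
    using src_rev[of "\<rho> i x" u] by (simp add: act_append del: s_rho)
  also have "\<dots> = v" by (simp add: Cons.IH)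
  finally show ?case .
qed simp

lemma act_rev': "act (src \<rho> x u) (rev u) (act x u v) = v"
  using act_rev[of "src \<rho> x u" "rev u"] by (simp add: src_rev)

lemma act_inj: "act x u v = act x u w \<longleftrightarrow> v = w"
  by (metis act_rev')

text \<open>Such maps send roots at \<open>x\<close> to roots, so the image of a root has exactly
  one sign. The target point stays existential because no sign argument refers to it.\<close>

definition good :: "(int ^ 'i \<Rightarrow> int ^ 'i) \<Rightarrow> 'x \<Rightarrow> bool" where
  "good g x \<longleftrightarrow> (\<exists>z u. src \<rho> z u = x \<and> g = act z u)"

lemma good_id [simp]: "good id x"
  unfolding good_def by (rule exI[of _ x], rule exI[of _ "[]"]) simp

lemma good_act [simp]: "good (act x u) (src \<rho> x u)"
  unfolding good_def by blast

lemma good_comp: "good g x \<Longrightarrow> good (g \<circ> act x u) (src \<rho> x u)"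
  unfolding good_def by (metis act_append src_simps(3))

lemma good_s: "good g x \<Longrightarrow> good (g \<circ> s i x) (\<rho> i x)"
  using good_comp[of g x "[i]"] by simp

lemma good_linear: "good g x \<Longrightarrow> int_linear g"
  unfolding good_def using int_linear_act by blast

lemma good_not_both: "good g x \<Longrightarrow> v \<in> \<Delta> x \<Longrightarrow> nonneg (- g v) \<longleftrightarrow> \<not> nonneg (g v)"
  unfolding good_def using act_root root_not_both by blast

text \<open>With \<open>g = act z v\<close> for a reduced word \<open>v\<close>, the predicate \<open>red g x u\<close> says that \<open>v @ u\<close> is reduced:
  each letter \<open>k\<close> is appended to a prefix that keeps \<open>\<alpha>\<^sub>k\<close> positive.\<close>

primrec red :: "(int ^ 'i \<Rightarrow> int ^ 'i) \<Rightarrow> 'x \<Rightarrow> 'i list \<Rightarrow> bool" where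
  "red g x [] \<longleftrightarrow> True"
| "red g x (i # u) \<longleftrightarrow> nonneg (g (simple_root i)) \<and> red (g \<circ> s i x) (\<rho> i x) u"

lemma red_append: "red g x (u @ v) \<longleftrightarrow> red g x u \<and> red (g \<circ> act x u) (src \<rho> x u) v"
  by (induction u arbitrary: g x) (simp_all add: comp_assoc)

lemma red_snoc: "red g x (u @ [k]) \<longleftrightarrow> red g x u \<and> nonneg (g (act x u (simple_root k)))"
  by (simp only: red_append red.simps comp_apply simp_thms)

lemma act_snoc_simple:
  "act x (u @ [k]) (simple_root k) = - act x u (simple_root k)"
  by (simp add: act_append int_linear_uminus[OF int_linear_act])

text \<open>The last reflection negates \<open>simple_root k\<close>, which everything before it
  keeps positive.\<close>

lemma red_snoc_neg:
  assumes "good g x" "red g x (u @ [k])"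
  shows "nonneg (- g (act x (u @ [k]) (simple_root k)))"
  using assms by (simp add: red_append act_snoc_simple int_linear_uminus[OF good_linear])

section \<open>Rank two\<close>

abbreviation plane :: "'i \<Rightarrow> 'i \<Rightarrow> 'x \<Rightarrow> (int ^ 'i) set" where
  "plane i j x \<equiv> \<Delta> x \<inter> rank_two_cone i j"

lemma cone_iff:
  assumes "i \<noteq> j"
  shows "v \<in> rank_two_cone i j \<longleftrightarrow> nonneg v \<and> (\<forall>k. k \<noteq> i \<longrightarrow> k \<noteq> j \<longrightarrow> v $ k = 0)"
proof
  assume R: "nonneg v \<and> (\<forall>k. k \<noteq> i \<longrightarrow> k \<noteq> j \<longrightarrow> v $ k = 0)"
  then have "v = int (nat (v $ i)) *s simple_root i + int (nat (v $ j)) *s simple_root j"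
    using assms by (auto simp: vec_eq_iff nonneg_def)
  then show "v \<in> rank_two_cone i j" unfolding rank_two_cone_def by blast
qed (auto simp: rank_two_cone_def nonneg_def)

lemma cone_sym: "rank_two_cone i j = rank_two_cone j i"
  by (cases "i = j") (auto simp: cone_iff)

lemma coxeter_sym: "coxeter_number \<Delta> x i j = coxeter_number \<Delta> x j i"
  by (simp add: coxeter_number_def cone_sym[of i j])

lemma plane_comb:
  assumes "i \<noteq> j" "v \<in> rank_two_cone i j"
  shows "v = (v $ i) *s simple_root i + (v $ j) *s simple_root j" "0 \<le> v $ i" "0 \<le> v $ j"
  using assms by (auto simp: vec_eq_iff cone_iff nonneg_def)

lemma s_plane:
  assumes "i \<noteq> j" "k \<in> {i, j}" "v \<in> plane i j x" "v \<noteq> simple_root k"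
  shows "s k x v \<in> plane i j (\<rho> k x)"
proof -
  have "nonneg (s k x v)" using assms by (intro s_nonneg) (auto simp: cone_iff)
  then show ?thesis using assms by (auto simp: cone_iff s_root simple_reflection_off)
qed

lemma s_plane_neq:
  assumes "i \<noteq> j" "v \<in> plane i j x"
  shows "s k x v \<noteq> simple_root k"
proof
  assume "s k x v = simple_root k"
  then have "v = - simple_root k" by (metis s_s s_simple)
  then show False using assms by (auto simp: cone_iff)
qed

text \<open>The reflection in \<open>k\<close> matches the positive plane roots at the two points,
  except that \<open>simple_root k\<close> would turn negative and is put back. Hence their number,
  the Coxeter number, is constant along words in \<open>i\<close> and \<open>j\<close>.\<close>

lemma plane_step:
  assumes "i \<noteq> j" "k \<in> {i, j}"
  shows "plane i j (\<rho> k x) = insert (simple_root k) (s k x ` (plane i j x - {simple_root k}))"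
proof (intro equalityI subsetI)
  fix v assume v: "v \<in> plane i j (\<rho> k x)"
  show "v \<in> insert (simple_root k) (s k x ` (plane i j x - {simple_root k}))"
  proof (cases "v = simple_root k")
    case False
    then have "s k x v \<in> plane i j x" using s_plane[OF assms v] by simp
    moreover have "s k x v \<noteq> simple_root k" using s_plane_neq[OF assms(1) v, of k] by simp
    ultimately show ?thesis by (metis DiffI image_eqI insertCI s_s singletonD)
  qed simp
next
  fix v assume "v \<in> insert (simple_root k) (s k x ` (plane i j x - {simple_root k}))"
  then show "v \<in> plane i j (\<rho> k x)" using s_plane[OF assms] assms by (auto simp: cone_iff)
qed

lemma inj_s: "inj_on (s k x) A"
  by (metis inj_onI s_s)

lemma plane_card_step:
  assumes "i \<noteq> j" "k \<in> {i, j}"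
  shows "(finite (plane i j (\<rho> k x)) \<longleftrightarrow> finite (plane i j x)) \<and>
         card (plane i j (\<rho> k x)) = card (plane i j x)"
proof -
  have k: "simple_root k \<in> plane i j x" using assms by (auto simp: cone_iff)
  have nin: "simple_root k \<notin> s k x ` (plane i j x - {simple_root k})"
    using s_plane_neq[OF assms(1)] by (metis DiffE imageE)
  have fin: "finite (plane i j (\<rho> k x)) \<longleftrightarrow> finite (plane i j x)"
    unfolding plane_step[OF assms] by (simp add: finite_image_iff inj_s)
  show ?thesis
  proof (cases "finite (plane i j x)")
    case True
    then have "card (plane i j (\<rho> k x)) = Suc (card (plane i j x - {simple_root k}))"
      unfolding plane_step[OF assms] using nin by (simp add: card_image inj_s)
    also have "\<dots> = card (plane i j x)" using True k by (metis card_Suc_Diff1)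
    finally show ?thesis using fin by simp
  next
    case False
    then show ?thesis using fin by simp
  qed
qed

lemma coxeter_step:
  "i \<noteq> j \<Longrightarrow> set a \<subseteq> {i, j} \<Longrightarrow> coxeter_number \<Delta> (src \<rho> x a) i j = coxeter_number \<Delta> x i j"
proof (induction a arbitrary: x)
  case (Cons k a)
  have "coxeter_number \<Delta> (\<rho> k x) i j = coxeter_number \<Delta> x i j"
    unfolding coxeter_number_def using plane_card_step[of i j k x] Cons.prems by simp
  then show ?case using Cons by simp
qed simp

lemma coxeter_enat:
  assumes "i \<noteq> j"
  shows "coxeter_number \<Delta> x i j = enat m \<longleftrightarrow> finite (plane i j x) \<and> card (plane i j x) = m"
  using assms by (auto simp: coxeter_number_def)

lemma coxeter_pos:
  assumes "i \<noteq> j" "coxeter_number \<Delta> x i j = enat m" shows "m > 0"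
proof -
  have "simple_root i \<in> plane i j x" using assms(1) by (simp add: cone_iff)
  then show ?thesis using assms by (metis card_gt_0_iff coxeter_enat empty_iff)
qed

section \<open>Inversions of words in two letters\<close>

definition inversions :: "'i \<Rightarrow> 'i \<Rightarrow> 'x \<Rightarrow> 'i list \<Rightarrow> (int ^ 'i) set" where
  "inversions i j x a = {v \<in> plane i j (src \<rho> x a). nonneg (- act x a v)}"

text \<open>Inversions are collected at the source, so a new letter carries the old ones along by
  its reflection, and \<open>simple_root k\<close> joins them. It was kept positive, so it is not an
  old inversion, and no old inversion leaves the cone on the way.\<close>

lemma inversions_snoc:
  assumes "i \<noteq> j" "k \<in> {i, j}" "nonneg (act x a (simple_root k))"
  shows "inversions i j x (a @ [k]) = insert (simple_root k) (s k (src \<rho> x a) ` inversions i j x a)"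
    and "simple_root k \<notin> s k (src \<rho> x a) ` inversions i j x a"
proof -
  have n: "\<not> nonneg (- act x a (simple_root k))"
    using assms(3) act_root root_not_both simple_root_in by blast
  show "inversions i j x (a @ [k]) = insert (simple_root k) (s k (src \<rho> x a) ` inversions i j x a)"
  proof (intro equalityI subsetI)
    fix v assume "v \<in> inversions i j x (a @ [k])"
    then have v: "v \<in> plane i j (\<rho> k (src \<rho> x a))" "nonneg (- act x a (s k (src \<rho> x a) v))"
      by (auto simp: inversions_def act_append)
    show "v \<in> insert (simple_root k) (s k (src \<rho> x a) ` inversions i j x a)"
    proof (cases "v = simple_root k")
      case False
      then have "s k (src \<rho> x a) v \<in> inversions i j x a"
        using s_plane[OF assms(1,2) v(1)] v(2) by (simp add: inversions_def)
      then show ?thesis by (metis image_eqI insertCI s_s)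
    qed simp
  next
    fix v assume "v \<in> insert (simple_root k) (s k (src \<rho> x a) ` inversions i j x a)"
    then show "v \<in> inversions i j x (a @ [k])"
    proof
      assume "v = simple_root k"
      moreover have "simple_root k \<in> plane i j (\<rho> k (src \<rho> x a))"
        using assms(1,2) by (auto simp: cone_iff)
      ultimately show ?thesis
        using assms(3) act_snoc_simple[of x a k] by (simp add: inversions_def)
    next
      assume "v \<in> s k (src \<rho> x a) ` inversions i j x a"
      then obtain w where w: "v = s k (src \<rho> x a) w" "w \<in> plane i j (src \<rho> x a)"
        "nonneg (- act x a w)" by (auto simp: inversions_def)
      then have "w \<noteq> simple_root k" using n by auto
      then show ?thesis
        using s_plane[OF assms(1,2) w(2)] w(1,3) by (simp add: inversions_def act_append)
    qed
  qed
  show "simple_root k \<notin> s k (src \<rho> x a) ` inversions i j x a"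
    using s_plane_neq[OF assms(1)] by (auto simp: inversions_def) (metis IntI)
qed

text \<open>Every letter of a reduced word contributes exactly one inversion; the empty word has
  none, since no root has both signs.\<close>

lemma card_inversions:
  assumes "i \<noteq> j" "set a \<subseteq> {i, j}" "red id x a"
  shows "finite (inversions i j x a) \<and> card (inversions i j x a) = length a"
  using assms(2,3)
proof (induction a rule: rev_induct)
  case Nil
  have "inversions i j x [] = {}"
    using assms(1) by (auto simp: inversions_def cone_iff) (metis root_not_both)
  then show ?case by simp
next
  case (snoc k a)
  then have k: "k \<in> {i, j}" "nonneg (act x a (simple_root k))" by (auto simp: red_snoc)
  have "finite (inversions i j x a) \<and> card (inversions i j x a) = length a"
    using snoc by (auto simp: red_snoc)
  then show ?case using inversions_snoc[OF assms(1) k] by (simp add: card_image inj_s)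
qed

text \<open>A root in the cone is a combination of the two simple roots with coefficients at least
  0, so its image is negative as soon as theirs are.\<close>

lemma inversions_all:
  assumes "i \<noteq> j" "nonneg (- act x a (simple_root i))" "nonneg (- act x a (simple_root j))"
  shows "inversions i j x a = plane i j (src \<rho> x a)"
proof -
  have "nonneg (- act x a v)" if "v \<in> rank_two_cone i j" for v
  proof -
    have "- act x a v = (v $ i) *s (- act x a (simple_root i)) + (v $ j) *s (- act x a (simple_root j))"
      using int_linear_neg_comb[OF int_linear_act, of x a "v $ i" "simple_root i" "v $ j" "simple_root j"]
      unfolding plane_comb(1)[OF assms(1) that, symmetric] .
    then show ?thesis using plane_comb(2,3)[OF assms(1) that] assms(2,3) nonneg_comb by metis
  qed
  then show ?thesis by (auto simp: inversions_def)
qed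

text \<open>With fewer than \<open>m\<close> letters there are fewer inversions than positive plane
  roots, so the two simple roots are not both made negative. The one of the last letter is, hence
  the one of the next letter stays positive.\<close>

lemma alternating_red:
  assumes "i \<noteq> j" "coxeter_number \<Delta> x i j = enat m" "n \<le> m"
  shows "red id x (alternating i j n)"
  using assms(3)
proof (induction n)
  case (Suc n)
  let ?a = "alternating i j n"
  have r: "red id x ?a" by (rule Suc.IH[OF Suc_leD[OF Suc.prems]])
  show ?case
  proof (cases n)
    case 0 then show ?thesis by (simp add: alternating_Suc)
  next
    case (Suc n')
    \<comment> \<open>\<open>l\<close> is the last letter of the word so far and \<open>l'\<close>
      the one that comes next.\<close>
    define l where "l = (if even n' then i else j)"
    define l' where "l' = (if even n then i else j)"
    have l: "?a = alternating i j n' @ [l]" by (simp add: Suc l_def alternating_Suc)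
    have ll: "(l = i \<and> l' = j) \<or> (l = j \<and> l' = i)" by (auto simp: l_def l'_def Suc)
    have "nonneg (- act x ?a (simple_root l))"
      using red_snoc_neg[of id x "alternating i j n'" l] r l by simp
    moreover have "inversions i j x ?a \<noteq> plane i j (src \<rho> x ?a)"
    proof
      assume "inversions i j x ?a = plane i j (src \<rho> x ?a)"
      then have "card (plane i j (src \<rho> x ?a)) = n"
        using card_inversions[OF assms(1) set_alternating r] by simp
      moreover have "card (plane i j (src \<rho> x ?a)) = m"
        using coxeter_step[OF assms(1) set_alternating] assms(1,2) coxeter_enat by metis
      ultimately show False using \<open>Suc n \<le> m\<close> by simp
    qed
    ultimately have "\<not> nonneg (- act x ?a (simple_root l'))"
      using inversions_all[OF assms(1)] ll by metis
    then have "nonneg (act x ?a (simple_root l'))"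
      using act_root root_not_both simple_root_in by blast
    then show ?thesis using r unfolding alternating_Suc red_snoc id_apply l'_def by blast
  qed
qed simp

text \<open>A reduced word of length \<open>m\<close> has \<open>m\<close> inversions, which
  exhausts the positive plane roots.\<close>

lemma alternating_neg:
  assumes "i \<noteq> j" "coxeter_number \<Delta> x i j = enat m" "k \<in> {i, j}"
  shows "nonneg (- act x (alternating i j m) (simple_root k))"
proof -
  let ?a = "alternating i j m"
  have "finite (plane i j (src \<rho> x ?a)) \<and> card (plane i j (src \<rho> x ?a)) = m"
    using coxeter_step[OF assms(1) set_alternating] assms(1,2) coxeter_enat by metis
  moreover have "inversions i j x ?a \<subseteq> plane i j (src \<rho> x ?a)" by (auto simp: inversions_def)
  ultimately have "inversions i j x ?a = plane i j (src \<rho> x ?a)"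
    using card_inversions[OF assms(1) set_alternating alternating_red[OF assms(1,2) order_refl]]
    by (metis card_subset_eq length_alternating)
  moreover have "simple_root k \<in> plane i j (src \<rho> x ?a)" using assms by (auto simp: cone_iff)
  ultimately show ?thesis unfolding inversions_def by blast
qed

lemma src_alternating:
  assumes "i \<noteq> j" "coxeter_number \<Delta> x i j = enat m"
  shows "src \<rho> x (alternating i j (2 * m)) = x"
    and "src \<rho> x (alternating i j m) = src \<rho> x (alternating j i m)"
proof -
  \<comment> \<open>Reading a word applies the first letter first, so the axiom is taken with
    \<open>i\<close> and \<open>j\<close> exchanged.\<close>
  have e: "((\<rho> j \<circ> \<rho> i) ^^ m) x = x"
    using roots assms coxeter_sym[of x i j] unfolding generalized_root_system_def by metis
  have "src \<rho> z (concat (replicate n [i, j])) = ((\<rho> j \<circ> \<rho> i) ^^ n) z" for n z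
    by (induction n arbitrary: z) (simp_all add: funpow_swap1)
  then show 2: "src \<rho> x (alternating i j (2 * m)) = x" using e by (simp add: alternating_double(2))
  \<comment> \<open>The double word, one alternating word followed by the reverse of the other,
    returns to \<open>x\<close>; reading the other word from there leads back to the source of the
    first.\<close>
  show "src \<rho> x (alternating i j m) = src \<rho> x (alternating j i m)"
    using 2 src_rev[of "src \<rho> x (alternating i j m)" "rev (alternating j i m)"]
    by (simp add: alternating_double(1))
qed

text \<open>The determinant on the plane separates the two ways in which the longest word can permute the
  simple roots up to sign.\<close>

definition det2 :: "'i \<Rightarrow> 'i \<Rightarrow> (int ^ 'i \<Rightarrow> int ^ 'i) \<Rightarrow> int" where
  "det2 i j g = g (simple_root i) $ i * g (simple_root j) $ j - g (simple_root i) $ j * g (simple_root j) $ i"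

text \<open>A column operation: the column of \<open>k\<close> is negated, and a multiple of it is
  added to the other column.\<close>

lemma det2_s:
  assumes "i \<noteq> j" "k \<in> {i, j}" "int_linear g"
  shows "det2 i j (g \<circ> s k x) = - det2 i j g"
proof -
  have *: "g (s k x (simple_root l)) = g (simple_root l) - C x $ k $ l *s g (simple_root k)" for l
    using int_linear_diff[OF assms(3)] by (simp add: reflection_simple_root)
  show ?thesis using assms(2) unfolding det2_def comp_def
    by (auto simp: * int_linear_uminus[OF assms(3)] simp del: s_simple) (simp_all add: algebra_simps)
qed

lemma det2_act:
  "i \<noteq> j \<Longrightarrow> set a \<subseteq> {i, j} \<Longrightarrow> det2 i j (act x a) = (- 1) ^ length a"
proof (induction a rule: rev_induct)
  case (snoc k a)
  then have ih: "det2 i j (act x a) = (- 1) ^ length a" and k: "k \<in> {i, j}" by simp_all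
  show ?case unfolding act_snoc det2_s[OF snoc.prems(1) k int_linear_act] ih by simp
qed (simp add: det2_def)

lemma act_off: "set a \<subseteq> {i, j} \<Longrightarrow> k \<noteq> i \<Longrightarrow> k \<noteq> j \<Longrightarrow> act x a v $ k = v $ k"
proof (induction a arbitrary: x)
  case (Cons l a)
  then show ?case by (auto simp: simple_reflection_off)
qed simp

lemma act_plane_neg:
  assumes "i \<noteq> j" "set a \<subseteq> {i, j}" "v \<in> plane i j (src \<rho> x a)" "nonneg (- act x a v)"
  shows "- act x a v \<in> plane i j x"
  using assms by (auto simp: cone_iff act_off root_uminus act_root)

text \<open>The negated action maps the positive plane roots at the source injectively into those at
  \<open>x\<close>. Both sets have the same size, so \<open>simple_root k\<close> is attained, by
  some \<open>v\<close>. Expanding \<open>v\<close> writes \<open>simple_root k\<close> as a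
  combination of the images of the two simple roots, and then one of these images must equal
  it.\<close>

lemma longest_perm:
  assumes "i \<noteq> j" "coxeter_number \<Delta> x i j = enat m" "k \<in> {i, j}"
  shows "\<exists>l\<in>{i, j}. act x (alternating i j m) (simple_root l) = - simple_root k"
proof -
  let ?a = "alternating i j m" let ?y = "src \<rho> x ?a"
  have n: "\<And>k. k \<in> {i, j} \<Longrightarrow> nonneg (- act x ?a (simple_root k))"
    using alternating_neg[OF assms(1,2)] .
  let ?f = "\<lambda>v. - act x ?a v"
  have sub: "?f ` plane i j ?y \<subseteq> plane i j x"
  proof safe
    fix v assume v: "v \<in> \<Delta> ?y" "v \<in> rank_two_cone i j"
    then have "v \<in> inversions i j x ?a" using inversions_all[OF assms(1) n n] by auto
    then have "nonneg (?f v)" by (simp add: inversions_def)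
    then have "?f v \<in> plane i j x" using act_plane_neg[OF assms(1) set_alternating] v by blast
    then show "?f v \<in> \<Delta> x" "?f v \<in> rank_two_cone i j" by auto
  qed
  have c: "finite (plane i j x)" "card (plane i j ?y) = card (plane i j x)"
    using coxeter_step[OF assms(1) set_alternating[of i j m], of x] assms(1,2) by (simp_all add: coxeter_enat)
  have "inj_on ?f (plane i j ?y)" by (auto simp: inj_on_def act_inj)
  then have "?f ` plane i j ?y = plane i j x"
    using sub c by (simp add: card_image card_subset_eq)
  moreover have "simple_root k \<in> plane i j x" using assms by (auto simp: cone_iff)
  ultimately obtain v where v: "v \<in> plane i j ?y" "act x ?a v = - simple_root k"
    by (metis (no_types, lifting) imageE minus_minus)
  let ?p = "- act x ?a (simple_root i)" and ?q = "- act x ?a (simple_root j)"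
  have pq: "?p \<in> plane i j x" "?q \<in> plane i j x"
    using n assms(1) act_plane_neg[OF assms(1) set_alternating, of _ x m] by (simp_all add: cone_iff)
  have np: "nonneg ?p" "nonneg ?q" using n by auto
  have vc: "v = (v $ i) *s simple_root i + (v $ j) *s simple_root j" "0 \<le> v $ i" "0 \<le> v $ j"
    using plane_comb[OF assms(1)] v(1) by blast+
  have eq: "simple_root k = (v $ i) *s ?p + (v $ j) *s ?q"
  proof -
    have "- act x ?a v = (v $ i) *s ?p + (v $ j) *s ?q"
      using int_linear_neg_comb[OF int_linear_act, of x ?a "v $ i" "simple_root i" "v $ j" "simple_root j"]
      unfolding vc(1)[symmetric] .
    then show ?thesis using v(2) by simp
  qed
  \<comment> \<open>Simple roots are indecomposable: a summand with positive coefficient has no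
    coordinate outside \<open>k\<close>, because nonnegative terms with sum 0 vanish.\<close>
  have key: "r = simple_root k" if "r \<in> \<Delta> x" "nonneg r" "0 < c" "simple_root k = c *s r + d *s t"
    "nonneg t" "0 \<le> d" for r c d t
  proof (rule simple_multiple_root[OF that(1,2)])
    fix l assume "l \<noteq> k"
    then have "0 = c * r $ l + d * t $ l" using arg_cong[OF that(4), of "\<lambda>w. w $ l"] by simp
    moreover have "0 \<le> d * t $ l" "0 \<le> c * r $ l" using that by (auto simp: nonneg_def)
    ultimately have "c * r $ l = 0" by linarith
    then show "r $ l = 0" using that(3) by simp
  qed
  have "v $ i \<noteq> 0 \<or> v $ j \<noteq> 0"
  proof (rule ccontr)
    assume "\<not> ?thesis"
    then have "v = 0" using vc(1) by (simp add: vec_eq_iff)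
    then show False using v(1) root_nonzero by blast
  qed
  then have "?p = simple_root k \<or> ?q = simple_root k"
  proof
    assume "v $ i \<noteq> 0"
    then show ?thesis using key[of ?p "v $ i" "v $ j" ?q] pq np vc eq by auto
  next
    assume "v $ j \<noteq> 0"
    then show ?thesis using key[of ?q "v $ j" "v $ i" ?p] pq np vc eq by (simp add: add.commute)
  qed
  then show ?thesis by (metis insertCI minus_minus)
qed

text \<open>The two simple roots go to the negatives of simple roots in one of two orders. The
  determinant is 1 if the order is kept and -1 if it is exchanged, so its value
  \<open>(-1) ^ m\<close> decides.\<close>

lemma longest_simple:
  assumes "i \<noteq> j" "coxeter_number \<Delta> x i j = enat m"
  shows "act x (alternating i j m) (simple_root (if even m then i else j)) = - simple_root i"
    and "act x (alternating i j m) (simple_root (if even m then j else i)) = - simple_root j"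
proof -
  let ?g = "act x (alternating i j m)"
  have d: "det2 i j ?g = (-1) ^ m"
    using det2_act[OF assms(1) set_alternating[of i j m]] by simp
  obtain l where l: "l \<in> {i, j}" "?g (simple_root l) = - simple_root i"
    using longest_perm[OF assms, of i] by auto
  obtain l' where l': "l' \<in> {i, j}" "?g (simple_root l') = - simple_root j"
    using longest_perm[OF assms, of j] by auto
  have "l \<noteq> l'" using l(2) l'(2) assms(1) by auto
  then have "(l = i \<and> l' = j) \<or> (l = j \<and> l' = i)" using l(1) l'(1) by auto
  then show "?g (simple_root (if even m then i else j)) = - simple_root i"
    "?g (simple_root (if even m then j else i)) = - simple_root j"
    using d l(2) l'(2) assms(1) by (auto simp: det2_def split: if_splits)
qed

section \<open>Rank two words behind a prefix\<close>

lemma good_cone: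
  assumes "i \<noteq> j" "good g x" "nonneg (g (simple_root i))" "nonneg (g (simple_root j))"
    "v \<in> rank_two_cone i j"
  shows "nonneg (g v)"
  using nonneg_comb[OF assms(3,4) plane_comb(2,3)[OF assms(1,5)]]
  unfolding int_linearD[OF good_linear[OF assms(2)], symmetric] plane_comb(1)[OF assms(1,5), symmetric] .

text \<open>A word in \<open>i\<close> and \<open>j\<close> sends these simple roots to roots
  without other coordinates, and on such roots \<open>g\<close> preserves signs because it keeps
  both simple roots positive.\<close>

lemma red_relative:
  assumes "i \<noteq> j" "set a \<subseteq> {i, j}" "good g x"
    "nonneg (g (simple_root i))" "nonneg (g (simple_root j))"
  shows "red g x a \<longleftrightarrow> red id x a"
proof -
  have pos: "nonneg (g v)" if "v \<in> rank_two_cone i j" for v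
    by (rule good_cone[OF assms(1,3,4,5) that])
  have iff: "nonneg (g v) \<longleftrightarrow> nonneg v"
    if "v \<in> \<Delta> x" "\<forall>k. k \<noteq> i \<longrightarrow> k \<noteq> j \<longrightarrow> v $ k = 0" for v
  proof -
    have "nonneg (g v)" if "nonneg v" using that pos \<open>\<forall>k. _\<close> assms(1) by (simp add: cone_iff)
    moreover have "nonneg (- g v)" if "nonneg (- v)"
      using that pos[of "- v"] \<open>\<forall>k. _\<close> assms(1)
      by (simp add: cone_iff int_linear_uminus[OF good_linear[OF assms(3)]])
    ultimately show ?thesis
      using root_not_both[OF that(1)] good_not_both[OF assms(3) that(1)] by blast
  qed
  show ?thesis using assms(2)
  proof (induction a rule: rev_induct)
    case (snoc k a)
    have "nonneg (g (act x a (simple_root k))) \<longleftrightarrow> nonneg (act x a (simple_root k))"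
      using snoc.prems act_off[of a i j] by (intro iff act_root) auto
    then show ?case using snoc unfolding red_snoc id_apply by simp
  qed simp
qed

text \<open>What matters is the symmetry of the right-hand side in \<open>i\<close> and
  \<open>j\<close>: it makes reducedness invariant under braid moves.\<close>

lemma red_alternating_iff:
  assumes "i \<noteq> j" "coxeter_number \<Delta> x i j = enat m" "good g x"
  shows "red g x (alternating i j m) \<longleftrightarrow> nonneg (g (simple_root i)) \<and> nonneg (g (simple_root j))"
proof
  assume r: "red g x (alternating i j m)"
  obtain n where n: "m = Suc n" using coxeter_pos[OF assms(1,2)] gr0_implies_Suc by blast
  have "nonneg (g (simple_root i))" using r n by (simp add: alternating_Cons)
  \<comment> \<open>The last letter of a word of length \<open>Suc n\<close> is
    \<open>if even n then i else j\<close>. The longest word sends its simple root to the negative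
    of \<open>simple_root j\<close>, whose sign under \<open>g\<close> can thus be read off.\<close>
  moreover have "nonneg (- g (act x (alternating i j m) (simple_root (if even m then j else i))))"
    using red_snoc_neg[OF assms(3), of "alternating i j n" "if even n then i else j"] r n
    by (cases "even n") (simp_all add: alternating_Suc)
  then have "nonneg (g (simple_root j))"
    unfolding longest_simple(2)[OF assms(1,2)] by (simp add: int_linear_uminus[OF good_linear[OF assms(3)]])
  ultimately show "nonneg (g (simple_root i)) \<and> nonneg (g (simple_root j))" by simp
next
  assume "nonneg (g (simple_root i)) \<and> nonneg (g (simple_root j))"
  then show "red g x (alternating i j m)"
    using red_relative[OF assms(1) set_alternating assms(3)] alternating_red[OF assms(1,2) order_refl]
    by blast
qed

text \<open>The quotient \<open>?w\<close> of the two words fixes both simple roots of the plane and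
  adds to any other simple root a plane vector with coordinates at least 0. The inverse
  \<open>?w'\<close> subtracts that vector, and the same positivity holds for it, so the vector is
  0.\<close>

lemma act_alternating:
  assumes "i \<noteq> j" "coxeter_number \<Delta> x i j = enat m"
  shows "act x (alternating i j m) = act x (alternating j i m)"
proof -
  let ?a = "alternating i j m" and ?b = "alternating j i m" and ?y = "src \<rho> x (alternating i j m)"
  let ?w = "act x (?a @ rev ?b)" and ?w' = "act x (?b @ rev ?a)"
  have yy: "src \<rho> x ?b = ?y" using src_alternating[OF assms] by simp
  have sy: "src \<rho> x (?a @ rev ?b) = x" "src \<rho> x (?b @ rev ?a) = x"
    using src_rev[of x ?b] src_rev[of x ?a] yy by simp_all
  have c': "coxeter_number \<Delta> x j i = enat m" using assms(2) coxeter_sym by metis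
  have inv: "?w (?w' v) = v" for v
    using act_rev[of x ?a v] act_rev'[of x ?b] by (simp add: act_append yy)
  have inv': "?w' (?w v) = v" for v
    using act_rev[of x ?b v] act_rev'[of x ?a] by (simp add: act_append yy)
  have agree: "act x ?a (simple_root k) = act x ?b (simple_root k)" if "k \<in> {i, j}" for k
    using that longest_simple[OF assms] longest_simple[OF assms(1)[symmetric] c']
    by (auto split: if_splits)
  have fix_pl: "?w (simple_root k) = simple_root k" if "k \<in> {i, j}" for k
  proof -
    have "\<exists>l\<in>{j, i}. act x ?b (simple_root l) = - simple_root k"
      by (rule longest_perm[OF assms(1)[symmetric] c']) (use that in auto)
    then obtain l where "l \<in> {j, i}" and l': "act x ?b (simple_root l) = - simple_root k" ..
    then have l: "l \<in> {i, j}" "act x ?b (simple_root l) = - simple_root k" by auto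
    have "act ?y (rev ?b) (- simple_root k) = simple_root l"
      using act_rev'[of x ?b "simple_root l"] l(2) yy by simp
    then have "act ?y (rev ?b) (simple_root k) = - simple_root l"
      using int_linear_uminus[OF int_linear_act] by (metis minus_minus)
    then show ?thesis
      using agree[OF l(1)] l(2) by (simp add: act_append int_linear_uminus[OF int_linear_act])
  qed
  have sets: "set (?a @ rev ?b) \<subseteq> {i, j}" "set (?b @ rev ?a) \<subseteq> {i, j}"
    using set_alternating[of i j m] set_alternating[of j i m] by auto
  have fix_all: "?w (simple_root k) = simple_root k" for k
  proof (cases "k \<in> {i, j}")
    case False
    define p q where "p = ?w (simple_root k) $ i" and "q = ?w (simple_root k) $ j"
    have p: "?w (simple_root k) = simple_root k + (p *s simple_root i + q *s simple_root j)"
    proof -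
      have "?w (simple_root k) $ l = simple_root k $ l" if "l \<noteq> i" "l \<noteq> j" for l
        using act_off[OF sets(1)] that by simp
      then show ?thesis using False assms(1) unfolding vec_eq_iff p_def q_def
        by (auto simp del: simple_root_nth) (auto)
    qed
    \<comment> \<open>The coordinate \<open>k\<close> keeps its value 1, which rules out the
      negative sign.\<close>
    have nn: "nonneg (act x u (simple_root k))" if "set u \<subseteq> {i, j}" for u
    proof -
      have "act x u (simple_root k) $ k = 1" using act_off[OF that, of k] False by simp
      then have "\<not> nonneg (- act x u (simple_root k))" by (auto simp: nonneg_def intro!: exI[of _ k])
      then show ?thesis using act_root root_not_both simple_root_in by blast
    qed
    have "?w' (simple_root k + (p *s simple_root i + q *s simple_root j)) = simple_root k"
      using inv'[of "simple_root k"] p by simp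
    moreover have "?w' (simple_root l) = simple_root l" if "l \<in> {i, j}" for l
      using inv'[of "simple_root l"] fix_pl[OF that] by simp
    ultimately have p': "?w' (simple_root k) = simple_root k - (p *s simple_root i + q *s simple_root j)"
      using int_linear_add[OF int_linear_act] int_linearD[OF int_linear_act]
      by (smt (verit, best) add_diff_cancel_right' insertCI)
    have "0 \<le> p" "0 \<le> q" using nn[OF sets(1)] by (auto simp: p_def q_def nonneg_def)
    moreover have "p \<le> 0" "q \<le> 0"
    proof -
      have "0 \<le> ?w' (simple_root k) $ i" "0 \<le> ?w' (simple_root k) $ j"
        using nn[OF sets(2)] by (auto simp: nonneg_def)
      then show "p \<le> 0" "q \<le> 0" using False assms(1) unfolding p' by (auto split: if_splits)
    qed
    ultimately have "p = 0" "q = 0" by simp_all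
    then show ?thesis using p by simp
  qed (use fix_pl in auto)
  have "?w = id"
    by (rule linear_simple_ext[OF int_linear_act]) (use fix_all in \<open>auto simp: int_linear_def\<close>)
  then have "act x ?a v = act x ?b v" for v
    using act_rev'[of x ?b v] by (metis act_append comp_apply id_apply yy)
  then show ?thesis by blast
qed

end

context root_system
begin

section \<open>Exchange and Matsumoto's theorem\<close>

text \<open>Chains of moves, prepended one at a time. The replaced factor must have the Coxeter
  length at the point where it starts; since \<open>i\<close> and \<open>j\<close> may be exchanged,
  moves are reversible.\<close>

inductive braid :: "'x \<Rightarrow> 'i list \<Rightarrow> 'i list \<Rightarrow> bool" where
  braid_refl: "braid x u u"
| braid_step: "i \<noteq> j \<Longrightarrow> coxeter_number \<Delta> (src \<rho> x p) i j = enat m \<Longrightarrow>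
    braid x (p @ alternating j i m @ q) v \<Longrightarrow> braid x (p @ alternating i j m @ q) v"

lemma braid_trans: "braid x u v \<Longrightarrow> braid x v w \<Longrightarrow> braid x u w"
  by (induction rule: braid.induct) (auto intro: braid_step)

lemma braid_single:
  "i \<noteq> j \<Longrightarrow> coxeter_number \<Delta> (src \<rho> x p) i j = enat m \<Longrightarrow>
    braid x (p @ alternating i j m @ q) (p @ alternating j i m @ q)"
  by (rule braid_step[OF _ _ braid_refl])

lemma braid_sym: "braid x u v \<Longrightarrow> braid x v u"
proof (induction rule: braid.induct)
  case (braid_step i j x p m q v)
  then have "braid x (p @ alternating j i m @ q) (p @ alternating i j m @ q)"
    using braid_single coxeter_sym by metis
  then show ?case using braid_step braid_trans by blast
qed (rule braid_refl)

lemma braid_append: "braid x u v \<Longrightarrow> braid x (u @ w) (v @ w)"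
proof (induction rule: braid.induct)
  case (braid_step i j x p m q v)
  then show ?case using braid.braid_step[of i j x p m "q @ w" "v @ w"] by simp
qed (rule braid_refl)

lemma braid_length: "braid x u v \<Longrightarrow> length u = length v"
  by (induction rule: braid.induct) simp_all

lemma braid_src: "braid x u v \<Longrightarrow> src \<rho> x u = src \<rho> x v"
proof (induction rule: braid.induct)
  case (braid_step i j x p m q v)
  then show ?case using src_alternating(2)[OF braid_step(1,2)] by simp
qed simp

lemma braid_act: "braid x u v \<Longrightarrow> act x u = act x v"
proof (induction rule: braid.induct)
  case (braid_step i j x p m q v)
  then show ?case
    using src_alternating(2)[OF braid_step(1,2)] act_alternating[OF braid_step(1,2)]
    unfolding act_append src_simps by metis
qed simp

text \<open>Both alternating factors are reduced under the same condition and lead to the same point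
  and map, so the rest of the word sees no difference.\<close>

lemma braid_red: "braid x u v \<Longrightarrow> good g x \<Longrightarrow> red g x u \<longleftrightarrow> red g x v"
proof (induction arbitrary: g rule: braid.induct)
  case (braid_step i j x p m q v)
  let ?y = "src \<rho> x p" let ?h = "g \<circ> act x p"
  have h: "good ?h ?y" by (rule good_comp[OF braid_step.prems])
  have c': "coxeter_number \<Delta> ?y j i = enat m" using braid_step(2) coxeter_sym by metis
  have "red ?h ?y (alternating i j m) \<longleftrightarrow> red ?h ?y (alternating j i m)"
    using red_alternating_iff[OF braid_step(1,2) h] red_alternating_iff[OF braid_step(1)[symmetric] c' h]
    by blast
  then have "red g x (p @ alternating i j m @ q) \<longleftrightarrow> red g x (p @ alternating j i m @ q)"
    unfolding red_append src_simps src_alternating(2)[OF braid_step(1,2)] act_alternating[OF braid_step(1,2)]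
    by blast
  then show ?case using braid_step.IH[OF braid_step.prems] by blast
qed simp

lemma not_red_double: "good g x \<Longrightarrow> \<not> red g x (u @ [k, k] @ w)"
proof
  assume g: "good g x" and "red g x (u @ [k, k] @ w)"
  then have "nonneg (g (act x u (simple_root k)))" "nonneg (g (act x u (- simple_root k)))"
    by (simp_all add: red_append)
  then have "nonneg (- g (act x u (simple_root k)))"
    using int_linear_uminus[OF good_linear[OF g]] int_linear_uminus[OF int_linear_act] by metis
  then show False
    using \<open>nonneg (g (act x u (simple_root k)))\<close> good_not_both[OF g act_root] simple_root_in by blast
qed

lemma act_neg_iff: "nonneg (- act x u (simple_root k)) \<longleftrightarrow> \<not> nonneg (act x u (simple_root k))"
  using act_root root_not_both simple_root_in by blast

text \<open>Braid moves pull out of \<open>t\<close>, on the right, a longest possible alternating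
  factor in \<open>j\<close> and the last letter \<open>k\<close>. The remaining prefix keeps both
  simple roots positive, so the plane decides: either the factor ends in \<open>j\<close>, or it has
  Coxeter length and a braid move makes it end in \<open>j\<close>.\<close>

lemma exchange:
  assumes "red id x t" "\<not> nonneg (act x t (simple_root j))"
  shows "\<exists>t'. braid x t (t' @ [j])"
  using assms
proof (induction "length t" arbitrary: t j rule: less_induct)
  case less
  note red = less.prems(1)
  have "t \<noteq> []" using less.prems(2) by auto
  then obtain t0 k where t: "t = t0 @ [k]" by (metis rev_exhaust)
  show ?case
  proof (cases "k = j")
    case True
    then show ?thesis using t braid_refl by blast
  next
    case False
    define Q where "Q v p q n \<longleftrightarrow> braid x t (v @ alternating p q n) \<and> {p, q} = {j, k} \<and> n > 0"
      for v p q n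
    have "Q t0 k j 1" using False unfolding Q_def t
      by (auto simp: alternating_def intro: braid_refl)
    then have "\<exists>p q n. Q t0 p q n" by blast
    \<comment> \<open>Braid moves preserve length, so a shortest prefix \<open>v\<close> goes with a
      longest alternating factor.\<close>
    from ex_has_least_nat[of "\<lambda>v. \<exists>p q n. Q v p q n", OF this, of length]
    obtain v p q n where Q: "Q v p q n"
      and min: "\<And>v' p' q' n'. Q v' p' q' n' \<Longrightarrow> length v \<le> length v'" by blast
    let ?a = "alternating p q n" and ?y = "src \<rho> x v"
    have b: "braid x t (v @ ?a)" and pq: "{p, q} = {j, k}" and n: "n > 0" using Q by (auto simp: Q_def)
    have ne: "p \<noteq> q" using pq False by auto
    have len: "length v < length t" using braid_length[OF b] n by simp
    have rva: "red id x (v @ ?a)" using braid_red[OF b] red by simp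
    then have rv: "red id x v" and ra: "red (act x v) ?y ?a" by (simp_all add: red_append)
    obtain n' where n': "n = Suc n'" using n gr0_implies_Suc by blast
    have pos: "nonneg (act x v (simple_root l))" if l: "l \<in> {p, q}" for l
    proof (rule ccontr)
      assume "\<not> ?thesis"
      \<comment> \<open>By induction the shorter word \<open>v\<close> can be moved to end in
        \<open>l\<close>. If \<open>l = p\<close>, a letter is doubled, against reducedness;
        otherwise the alternating factor grows, against minimality.\<close>
      then obtain v' where v': "braid x v (v' @ [l])" using less.hyps[OF len rv] by blast
      then have b': "braid x t (v' @ [l] @ ?a)"
        using braid_trans[OF b braid_append[OF v']] by simp
      show False
      proof (cases "l = p")
        case True
        have "red id x (v' @ [l] @ ?a)" using braid_red[OF b'] red by simp
        then have "red id x (v' @ [p, p] @ alternating q p n')"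
          using True n' by (simp add: alternating_Cons)
        then show False using not_red_double by simp
      next
        case False
        then have "Q v' q p (Suc n)"
          using b' l pq by (auto simp: Q_def alternating_Cons)
        then show False using min[of v' q p "Suc n"] braid_length[OF v'] by simp
      qed
    qed
    have ra': "red id ?y ?a"
      using ra red_relative[OF ne set_alternating good_act pos pos] by simp
    \<comment> \<open>\<open>r\<close> is the last letter of the factor, \<open>r'\<close> that of
      the alternating word with \<open>p\<close> and \<open>q\<close> exchanged.\<close>
    define r r' where "r = (if even n' then p else q)" and "r' = (if even n' then q else p)"
    have a: "?a = alternating p q n' @ [r]" and a': "alternating q p n = alternating q p n' @ [r']"
      by (simp_all add: n' alternating_Suc r_def r'_def)
    have rr: "{r, r'} = {p, q}" "r \<noteq> r'" using ne by (auto simp: r_def r'_def)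
    show ?thesis
    proof (cases "r = j")
      case True
      then have "braid x t ((v @ alternating p q n') @ [j])" using b a by simp
      then show ?thesis by blast
    next
      case False
      then have rk: "r' = j" "r = k" using rr pq \<open>k \<noteq> j\<close> by blast+
      have "nonneg (- act ?y ?a (simple_root r))"
        using red_snoc_neg[of id ?y "alternating p q n'" r] ra' a by simp
      \<comment> \<open>Here \<open>r' = j\<close>: a positive image would lie in the cone, where
        \<open>v\<close> preserves positivity, although \<open>t\<close> makes
        \<open>simple_root j\<close> negative.\<close>
      moreover have "nonneg (- act ?y ?a (simple_root r'))"
      proof -
        have "\<not> nonneg (act ?y ?a (simple_root r'))"
        proof
          assume "nonneg (act ?y ?a (simple_root r'))"
          then have "act ?y ?a (simple_root r') \<in> rank_two_cone p q"
            using ne rr(1) act_off[OF set_alternating[of p q n]] by (auto simp: cone_iff)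
          then have "nonneg (act x v (act ?y ?a (simple_root r')))"
            by (intro good_cone[OF ne good_act pos pos]) auto
          then have "nonneg (act x t (simple_root j))"
            using rk unfolding braid_act[OF b] act_append by simp
          then show False using less.prems(2) by blast
        qed
        then show ?thesis by (simp only: act_neg_iff simp_thms)
      qed
      \<comment> \<open>Both simple roots turn negative, so all positive plane roots are inversions;
        there are \<open>n\<close> of them, which makes \<open>n\<close> the Coxeter number.\<close>
      ultimately have "inversions p q ?y ?a = plane p q (src \<rho> ?y ?a)"
        using rr by (intro inversions_all[OF ne]) (auto simp: doubleton_eq_iff)
      then have "coxeter_number \<Delta> (src \<rho> ?y ?a) p q = enat n"
        using card_inversions[OF ne set_alternating ra'] ne by (simp add: coxeter_enat)
      then have "coxeter_number \<Delta> ?y p q = enat n"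
        using coxeter_step[OF ne set_alternating] by metis
      from braid_trans[OF b] braid_single[OF ne this, of "[]"]
      have "braid x t (v @ alternating q p n)" by simp
      then have "braid x t ((v @ alternating q p n') @ [j])" using a' rk by simp
      then show ?thesis by blast
    qed
  qed
qed

text \<open>Induction on the last letter \<open>k\<close> of the first word: the common action makes
  \<open>simple_root k\<close> negative, so the second word can be exchanged to end in
  \<open>k\<close> as well, and the last reflection cancels.\<close>

lemma matsumoto:
  assumes "red id x u" "red id x v" "src \<rho> x u = src \<rho> x v" "act x u = act x v"
  shows "braid x u v"
  using assms
proof (induction u arbitrary: v rule: rev_induct)
  case Nil
  \<comment> \<open>A nonempty reduced word makes the simple root of its last letter negative, which
    the identity does not.\<close>
  have "v = []"
  proof (cases v rule: rev_cases)
    case (snoc v' k)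
    then have "nonneg (- act x v (simple_root k))"
      using red_snoc_neg[OF good_id, of x v' k] Nil(2) unfolding id_apply by blast
    then show ?thesis unfolding Nil(4)[symmetric] by simp
  qed
  then show ?case by (simp add: braid_refl)
next
  case (snoc k u)
  have "nonneg (- act x (u @ [k]) (simple_root k))"
    using red_snoc_neg[OF good_id snoc.prems(1)] unfolding id_apply .
  then have "\<not> nonneg (act x v (simple_root k))" using snoc.prems(4) act_neg_iff by metis
  then obtain v' where v': "braid x v (v' @ [k])" using exchange[OF snoc.prems(2)] by blast
  have r: "red id x u" "red id x v'"
    using snoc.prems(1,2) braid_red[OF v' good_id] unfolding red_snoc by blast+
  have "\<rho> k (src \<rho> x u) = \<rho> k (src \<rho> x v')" using snoc.prems(3) braid_src[OF v'] by simp
  then have s: "src \<rho> x u = src \<rho> x v'" by (metis rho_rho)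
  have e: "act x u (s k (src \<rho> x v') w) = act x v' (s k (src \<rho> x v') w)" for w
    using snoc.prems(4) unfolding braid_act[OF v'] act_snoc s by (metis comp_apply)
  have "act x u = act x v'"
  proof
    fix w show "act x u w = act x v' w"
      using e[of "s k (src \<rho> x v') w"] by simp
  qed
  then have "braid x u v'" using snoc.IH r s by blast
  then show ?case using braid_append braid_sym[OF v'] braid_trans by blast
qed

text \<open>At the first letter that breaks reducedness, the reduced prefix before it can be
  exchanged to end in that same letter.\<close>

lemma not_red_braid:
  assumes "\<not> red id x u"
  shows "\<exists>p k q. braid x u (p @ [k, k] @ q)"
  using assms
proof (induction u rule: rev_induct)
  case (snoc k u)
  show ?case
  proof (cases "red id x u")
    case False
    then obtain p l q where "braid x u (p @ [l, l] @ q)" using snoc.IH by blast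
    from braid_append[OF this, of "[k]"] show ?thesis by auto
  next
    case True
    then have "\<not> nonneg (act x u (simple_root k))" using snoc.prems unfolding red_snoc id_apply by blast
    then obtain t where "braid x u (t @ [k])" using exchange[OF True] by blast
    from braid_append[OF this, of "[k]"] show ?thesis by (metis append_Cons append_Nil append_Nil2 append_assoc)
  qed
qed simp

end

section \<open>Morphisms of the Weyl groupoid\<close>

context root_system
begin

abbreviation "weq \<equiv> weyl_eq \<rho> \<Delta>"

text \<open>The defining relations hold for the action: both kinds of letter act by the same
  involution, and a Coxeter relation for distinct letters is one alternating word followed by the
  reverse of the other.\<close>

lemma weyl_eq_src_act:
  "weq x u v \<Longrightarrow> src \<rho> x (map index u) = src \<rho> x (map index v) \<and>
     act x (map index u) = act x (map index v)"
proof (induction rule: weyl_eq.induct)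
  case (weyl_coxeter x i j m)
  have idx: "map index (concat (replicate m [Pos i, Pos j])) = alternating i j (2 * m)"
    by (simp add: map_concat map_replicate alternating_double(2)[symmetric])
  show ?case
  proof (cases "i = j")
    case True
    then have "m = 1" using weyl_coxeter by (simp add: coxeter_number_def one_enat_def)
    then show ?thesis using True by (simp add: fun_eq_iff)
  next
    case False
    have "act x (alternating i j (2 * m)) = id"
      unfolding alternating_double(1) act_append act_alternating[OF False weyl_coxeter]
        src_alternating(2)[OF False weyl_coxeter] by (simp add: fun_eq_iff act_rev)
    then show ?thesis unfolding idx using src_alternating(1)[OF False weyl_coxeter] by simp
  qed
next
  case (weyl_cong x p u v q)
  then show ?case unfolding map_append act_append src_simps by metis
qed (simp_all add: fun_eq_iff)

lemma weyl_eq_prepend: "weq (src \<rho> x (map index p)) u v \<Longrightarrow> weq x (p @ u) (p @ v)"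
  using weyl_cong[of \<rho> \<Delta> x p u v "[]"] by simp

lemma weyl_eq_append: "weq x u v \<Longrightarrow> weq x (u @ q) (v @ q)"
  using weyl_cong[of \<rho> \<Delta> x "[]" u v q] by simp

lemma weyl_eq_pos_pos: "weq x [Pos i, Pos i] []"
  using weyl_coxeter[of \<Delta> x i i 1 \<rho>] by (simp add: coxeter_number_def one_enat_def)

lemma weyl_eq_neg_pos: "weq x [Neg i] [Pos i]"
proof -
  \<comment> \<open>The word \<open>[Neg i, Pos i, Pos i]\<close> is simplified in two ways.\<close>
  have "weq x ([Neg i] @ [Pos i, Pos i]) ([Neg i] @ [])"
    by (intro weyl_eq_prepend weyl_eq_pos_pos)
  moreover have "weq x ([Neg i, Pos i] @ [Pos i]) ([] @ [Pos i])"
    by (intro weyl_eq_append weyl_left_inv)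
  ultimately show ?thesis using weyl_trans weyl_sym by fastforce
qed

lemma weyl_eq_positive: "weq x u (map Pos (map index u))"
proof (induction u arbitrary: x)
  case (Cons l u)
  have l: "weq x [l] [Pos (index l)]"
    by (cases l) (simp_all add: weyl_refl weyl_eq_neg_pos)
  have "weq x ([l] @ u) ([l] @ map Pos (map index u))"
    by (rule weyl_eq_prepend) (rule Cons.IH)
  from weyl_trans[OF this weyl_eq_append[OF l]] show ?case by simp
qed (simp add: weyl_refl)

lemma weyl_eq_double: "weq x (map Pos (p @ [k, k] @ q)) (map Pos (p @ q))"
  using weyl_eq_prepend[OF weyl_eq_append[OF weyl_eq_pos_pos], of x "map Pos p" k "map Pos q"] by simp

lemma weyl_eq_rev: "weq x (map Pos (rev u @ u)) []"
proof (induction u arbitrary: x)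
  case (Cons i u)
  show ?case using weyl_trans[OF weyl_eq_double[of x "rev u" i u] Cons.IH] by simp
qed (simp add: weyl_refl)

text \<open>This is the Coxeter relation multiplied on the right by one of the alternating words,
  whose reverse is its inverse.\<close>

lemma weyl_eq_alternating:
  assumes "coxeter_number \<Delta> x i j = enat m"
  shows "weq x (map Pos (alternating i j m)) (map Pos (alternating j i m))"
proof -
  let ?a = "map Pos (alternating i j m)" and ?b = "alternating j i m"
  have "concat (replicate m [Pos i, Pos j]) = ?a @ map Pos (rev ?b)"
    using arg_cong[OF alternating_double(2)[of m i j], of "map Pos"]
    by (simp add: alternating_double(1) map_concat map_replicate)
  then have "weq x (?a @ map Pos (rev ?b)) []" using weyl_coxeter[OF assms, of \<rho>] by simp
  from weyl_eq_append[OF this, of "map Pos ?b"]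
  have "weq x (?a @ map Pos (rev ?b @ ?b)) (map Pos ?b)" by simp
  moreover have "weq x (?a @ map Pos (rev ?b @ ?b)) (?a @ [])"
    by (rule weyl_eq_prepend[OF weyl_eq_rev])
  ultimately show ?thesis using weyl_trans weyl_sym by (metis append_Nil2)
qed

lemma braid_weyl_eq: "braid x u v \<Longrightarrow> weq x (map Pos u) (map Pos v)"
proof (induction rule: braid.induct)
  case (braid_step i j x p m q v)
  have "weq x (map Pos (p @ alternating i j m @ q)) (map Pos (p @ alternating j i m @ q))"
    using weyl_cong[of \<rho> \<Delta> x "map Pos p", OF _] weyl_eq_alternating[OF braid_step(2)]
    by (simp add: comp_def)
  from weyl_trans[OF this braid_step.IH] show ?case .
qed (rule weyl_refl)

lemma weyl_rel_equiv: "equiv UNIV (weyl_rel \<rho> \<Delta>)"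
  by (rule equivI) (auto simp: weyl_rel_def intro!: refl_onI symI transI
      intro: weyl_refl weyl_sym weyl_trans)

lemma sigma_prod_eq_iff:
  "sigma_prod \<rho> \<Delta> x u = sigma_prod \<rho> \<Delta> y v \<longleftrightarrow> x = y \<and> weq x (map Pos u) (map Pos v)"
  unfolding sigma_prod_def eq_equiv_class_iff[OF weyl_rel_equiv UNIV_I UNIV_I]
  by (auto simp: weyl_rel_def)

lemma braid_sigma_prod: "braid x u v \<Longrightarrow> sigma_prod \<rho> \<Delta> x u = sigma_prod \<rho> \<Delta> x v"
  by (simp add: sigma_prod_eq_iff braid_weyl_eq)

lemma sigma_prod_src_act:
  "sigma_prod \<rho> \<Delta> x u = sigma_prod \<rho> \<Delta> x v \<Longrightarrow> src \<rho> x u = src \<rho> x v \<and> act x u = act x v"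
  using weyl_eq_src_act[of x "map Pos u" "map Pos v"] by (simp add: sigma_prod_eq_iff comp_def)

text \<open>Otherwise braid moves create a repeated letter, and cancelling the pair contradicts
  minimality of the length.\<close>

lemma reduced_expression_red:
  assumes "reduced_expression \<rho> \<Delta> x u w" shows "red id x u"
proof (rule ccontr)
  assume "\<not> ?thesis"
  then obtain p k q where b: "braid x u (p @ [k, k] @ q)" using not_red_braid by blast
  have "sigma_prod \<rho> \<Delta> x u = sigma_prod \<rho> \<Delta> x (p @ q)"
    using weyl_trans[OF braid_weyl_eq[OF b] weyl_eq_double] by (simp add: sigma_prod_eq_iff)
  then have "weyl_length \<rho> \<Delta> w \<le> length (p @ q)"
    using assms unfolding weyl_length_def reduced_expression_def by (intro Least_le) blast
  then show False using assms braid_length[OF b] by (simp add: reduced_expression_def)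
qed

lemma ex_reduced_expression: "\<exists>y v. reduced_expression \<rho> \<Delta> y v (sigma_prod \<rho> \<Delta> x u)"
proof -
  let ?w = "sigma_prod \<rho> \<Delta> x u"
  have "\<exists>y v. length v = weyl_length \<rho> \<Delta> ?w \<and> ?w = sigma_prod \<rho> \<Delta> y v"
    unfolding weyl_length_def by (rule LeastI[of _ "length u"]) blast
  then show ?thesis by (auto simp: reduced_expression_def)
qed

text \<open>A shortest word for the same morphism has the same source and action, so it is related
  to \<open>u\<close> by braid moves and has the same length.\<close>

lemma reduced_expression_iff:
  "reduced_expression \<rho> \<Delta> x u w \<longleftrightarrow> w = sigma_prod \<rho> \<Delta> x u \<and> red id x u"
proof
  assume r: "w = sigma_prod \<rho> \<Delta> x u \<and> red id x u"
  then obtain y v where v: "reduced_expression \<rho> \<Delta> y v w" using ex_reduced_expression by blast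
  then have w: "sigma_prod \<rho> \<Delta> x u = sigma_prod \<rho> \<Delta> y v" using r by (simp add: reduced_expression_def)
  then have y: "y = x" by (simp add: sigma_prod_eq_iff)
  have "braid x u v"
    using matsumoto r reduced_expression_red[OF v] sigma_prod_src_act w unfolding y by blast
  then show "reduced_expression \<rho> \<Delta> x u w"
    using r v braid_length unfolding reduced_expression_def by metis
qed (use reduced_expression_red in \<open>auto simp: reduced_expression_def\<close>)

lemma reduced_expressions_braid:
  assumes "reduced_expression \<rho> \<Delta> x u w" "reduced_expression \<rho> \<Delta> y v w"
  shows "x = y \<and> braid x u v"
  using assms matsumoto sigma_prod_src_act unfolding reduced_expression_iff
  by (metis sigma_prod_eq_iff)

lemma weyl_morphisms_reduced:
  "w \<in> weyl_morphisms \<rho> \<Delta> \<longleftrightarrow> (\<exists>x u. reduced_expression \<rho> \<Delta> x u w)"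
proof
  assume "w \<in> weyl_morphisms \<rho> \<Delta>"
  then obtain x u where w: "w = weyl_rel \<rho> \<Delta> `` {(x, u)}"
    unfolding weyl_morphisms_def weyl_hom_def by (auto elim!: quotientE)
  have "w = sigma_prod \<rho> \<Delta> x (map index u)"
    unfolding w sigma_prod_def eq_equiv_class_iff[OF weyl_rel_equiv UNIV_I UNIV_I]
    using weyl_eq_positive by (auto simp: weyl_rel_def)
  then show "\<exists>x u. reduced_expression \<rho> \<Delta> x u w" using ex_reduced_expression by blast
next
  assume "\<exists>x u. reduced_expression \<rho> \<Delta> x u w"
  then show "w \<in> weyl_morphisms \<rho> \<Delta>"
    unfolding weyl_morphisms_def weyl_hom_def reduced_expression_def sigma_prod_def
    by (auto intro!: quotientI)
qed

end

section \<open>A representation of the free algebra\<close>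

lemma poly_mapping_additive_induct [case_names single add]:
  fixes f :: "'a \<Rightarrow>\<^sub>0 'b::comm_monoid_add"
  assumes single: "\<And>u c. P (Poly_Mapping.single u c)"
    and add: "\<And>f g. P f \<Longrightarrow> P g \<Longrightarrow> P (f + g)"
  shows "P f"
proof -
  have "P (\<Sum>u\<in>A. Poly_Mapping.single u (Poly_Mapping.lookup f u))" for A
    \<comment> \<open>\<open>Poly_Mapping.single undefined 0\<close> is 0, the value of the empty
      sum.\<close>
    using single[of undefined 0]
    by (induction A rule: infinite_finite_induct) (simp_all add: single add)
  moreover have "(\<Sum>u\<in>Poly_Mapping.keys f. Poly_Mapping.single u (Poly_Mapping.lookup f u)) = f"
    by (rule poly_mapping_eqI) (simp add: lookup_sum lookup_single when_def in_keys_iff)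
  ultimately show ?thesis by metis
qed

definition free_gen :: "('x, 'i) nil_gen \<Rightarrow> ('x, 'i, 'k::{comm_ring, comm_monoid_mult}) nil_free" where
  "free_gen a = Poly_Mapping.single (FMon [a]) 1"

lemma free_gen_simps: "free_e x = free_gen (Gen_e x)" "free_n x i = free_gen (Gen_n x i)"
  by (simp_all add: free_gen_def free_e_def free_n_def)

lemma fmon_add: "FMon u + FMon v = FMon (u @ v)"
  by (simp add: plus_fmon_def)

lemma single_Cons: "Poly_Mapping.single (FMon (a # l)) c = free_gen a * Poly_Mapping.single (FMon l) c"
  by (simp add: free_gen_def mult_single fmon_add)

lemma free_const_one_mult [simp]: "free_const 1 * f = f"
  by (induction f rule: poly_mapping_additive_induct)
     (simp_all add: free_const_def mult_single distrib_left)

lemma mult_free_const_one [simp]: "f * free_const 1 = f"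
  by (induction f rule: poly_mapping_additive_induct)
     (simp_all add: free_const_def mult_single distrib_right mult.commute)

lemma free_const_commute: "free_const c * f = f * free_const c"
  by (induction f rule: poly_mapping_additive_induct)
     (simp_all add: free_const_def mult_single distrib_left distrib_right mult.commute)

lemma free_const_add: "free_const (a + b) = free_const a + free_const b"
  by (simp add: free_const_def single_add)

lemma free_const_0 [simp]: "free_const 0 = 0"
  by (simp add: free_const_def)

locale finite_root_system = root_system \<rho> C \<Delta>
  for \<rho> :: "'i::finite \<Rightarrow> 'x::finite \<Rightarrow> 'x" and C \<Delta>
begin

text \<open>A state \<open>(z, g)\<close> records the current point and the action of the word read so far; a generator
  \<open>n\<close> moves a state only if it lengthens that word.\<close>

type_synonym ('a, 'b) state = "'a \<times> (int ^ 'b \<Rightarrow> int ^ 'b)"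

primrec gen_step :: "('x, 'i) nil_gen \<Rightarrow> ('x, 'i) state \<Rightarrow> ('x, 'i) state option" where
  "gen_step (Gen_e x) st = (if fst st = x then Some st else None)"
| "gen_step (Gen_n x i) st =
     (if fst st = x \<and> nonneg (snd st (simple_root i)) then Some (\<rho> i x, snd st \<circ> s i x) else None)"

primrec word_step :: "('x, 'i) nil_gen list \<Rightarrow> ('x, 'i) state \<Rightarrow> ('x, 'i) state option" where
  "word_step [] st = Some st"
| "word_step (a # l) st = Option.bind (gen_step a st) (word_step l)"

lemma word_step_append: "word_step (u @ v) st = Option.bind (word_step u st) (word_step v)"
  by (induction u arbitrary: st) (auto split: bind_splits)

definition extend :: "(('x, 'i) state \<Rightarrow> 'k::zero) \<Rightarrow> ('x, 'i) state option \<Rightarrow> 'k" where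
  "extend \<phi> o' = (case o' of None \<Rightarrow> 0 | Some t \<Rightarrow> \<phi> t)"

lemma extend_simps [simp]: "extend \<phi> None = 0" "extend \<phi> (Some t) = \<phi> t"
  by (simp_all add: extend_def)

text \<open>Words move states starting with the leftmost letter; passing to functions of the final
  state reverses the order and gives a left module. A blocked word contributes 0.\<close>

definition operate ::
  "('x, 'i, 'k::{comm_ring, comm_monoid_mult}) nil_free \<Rightarrow> (('x, 'i) state \<Rightarrow> 'k) \<Rightarrow> ('x, 'i) state \<Rightarrow> 'k" where
  "operate f \<phi> st =
     (\<Sum>u\<in>Poly_Mapping.keys f. Poly_Mapping.lookup f u * extend \<phi> (word_step (fmon_list u) st))"

lemma operate_single: "operate (Poly_Mapping.single u c) \<phi> st = c * extend \<phi> (word_step (fmon_list u) st)"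
  by (simp add: operate_def)

lemma operate_add: "operate (f + g) \<phi> st = operate f \<phi> st + operate g \<phi> st"
  unfolding operate_def by (rule setsum_keys_plus_distrib) (simp_all add: distrib_right)

lemma operate_0 [simp]: "operate 0 \<phi> st = 0"
  by (simp add: operate_def)

lemma operate_uminus: "operate (- f) \<phi> st = - operate f \<phi> st"
  using operate_add[of f "- f" \<phi> st] by (simp add: eq_neg_iff_add_eq_0 add.commute)

lemma operate_diff: "operate (f - g) \<phi> st = operate f \<phi> st - operate g \<phi> st"
  using operate_add[of f "- g" \<phi> st] by (simp add: operate_uminus)

lemma operate_sum: "operate (\<Sum>a\<in>A. f a) \<phi> st = (\<Sum>a\<in>A. operate (f a) \<phi> st)"
  by (induction A rule: infinite_finite_induct) (simp_all add: operate_add)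

lemma operate_fun_add: "operate f (\<lambda>t. \<phi> t + \<psi> t) st = operate f \<phi> st + operate f \<psi> st"
proof -
  have "extend (\<lambda>t. \<phi> t + \<psi> t) o' = extend \<phi> o' + extend \<psi> o'" for o'
    by (cases o') simp_all
  then show ?thesis by (simp add: operate_def distrib_left sum.distrib)
qed

lemma operate_mult: "operate (f * g) \<phi> st = operate f (operate g \<phi>) st"
proof (induction f rule: poly_mapping_additive_induct)
  case (single u c)
  show ?case
  proof (induction g rule: poly_mapping_additive_induct)
    case (single v d)
    have "extend \<phi> (word_step (fmon_list u @ fmon_list v) st) * d =
        extend (\<lambda>t. d * extend \<phi> (word_step (fmon_list v) t)) (word_step (fmon_list u) st)"
      by (cases "word_step (fmon_list u) st") (simp_all add: word_step_append mult.commute)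
    then show ?case
      by (simp add: mult_single operate_single plus_fmon_def mult.assoc mult.commute[of d] ext[of "operate _ \<phi>"])
  next
    case (add f g)
    then show ?case
      by (simp add: distrib_left operate_add operate_fun_add[symmetric] ext[OF operate_add])
  qed
next
  case (add f g)
  then show ?case by (simp add: distrib_right operate_add)
qed

lemma operate_const: "operate (free_const c) \<phi> st = c * \<phi> st"
  by (simp add: free_const_def operate_single zero_fmon_def)

lemma operate_e: "operate (free_e x) \<phi> (z, g) = (if z = x then \<phi> (z, g) else 0)"
  by (simp add: free_e_def operate_single)

lemma operate_n:
  "operate (free_n x i) \<phi> (z, g) =
     (if z = x \<and> nonneg (g (simple_root i)) then \<phi> (\<rho> i x, g \<circ> s i x) else 0)"
  by (simp add: free_n_def operate_single)

lemma operate_n_prod: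
  "operate (free_n_prod \<rho> x u) \<phi> (x, g) =
     (if red g x u then \<phi> (src \<rho> x u, g \<circ> act x u) else 0)"
  by (induction u arbitrary: x g) (simp_all add: operate_const operate_mult operate_n comp_assoc)

text \<open>A nonempty word starts with a generator tied to the point \<open>x\<close>, whereas the
  empty product is 1 and acts everywhere.\<close>

lemma operate_n_prod_off:
  "u \<noteq> [] \<Longrightarrow> z \<noteq> x \<Longrightarrow> operate (free_n_prod \<rho> x u) \<phi> (z, g) = 0"
  by (cases u) (simp_all add: operate_mult operate_n)

text \<open>Only states reached by words are tested: the nil and braid relations rely on images of
  roots having exactly one sign.\<close>

definition annihilator :: "('x, 'i, 'k::{comm_ring, comm_monoid_mult}) nil_free set" where
  "annihilator = {f. \<forall>\<phi> z g. good g z \<longrightarrow> operate f \<phi> (z, g) = 0}"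

lemma operate_good_cong:
  assumes "good g z" "\<And>z g. good g z \<Longrightarrow> \<phi> (z, g) = \<psi> (z, g)"
  shows "operate f \<phi> (z, g) = operate f \<psi> (z, g)"
proof -
  have gen: "good (snd t) (fst t)" if "gen_step a st = Some t" "good (snd st) (fst st)" for a st t
    using that good_s by (cases a) (auto split: if_splits)
  have word: "good (snd t) (fst t)" if "word_step l st = Some t" "good (snd st) (fst st)" for l st t
    using that by (induction l arbitrary: st) (auto simp: bind_eq_Some_conv dest: gen)
  have "extend \<phi> (word_step l (z, g)) = extend \<psi> (word_step l (z, g))" for l
  proof (cases "word_step l (z, g)")
    case (Some t)
    then show ?thesis using assms(2)[of "snd t" "fst t"] word[OF Some] assms(1) by simp
  qed simp
  then show ?thesis by (simp add: operate_def)
qed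

text \<open>For \<open>h * f\<close>: generators never leave the tested states, so there
  \<open>operate f \<phi>\<close> may be replaced by the zero function.\<close>

lemma annihilator_mult:
  fixes f :: "('x, 'i, 'k::{comm_ring, comm_monoid_mult}) nil_free"
  assumes "f \<in> annihilator" shows "f * h \<in> annihilator" "h * f \<in> annihilator"
proof -
  show "f * h \<in> annihilator" using assms by (simp add: annihilator_def operate_mult)
  have "operate h (operate f \<phi>) (z, g) = operate h (\<lambda>_. 0) (z, g)" if "good g z" for \<phi> z g
    using assms by (intro operate_good_cong[OF that]) (simp add: annihilator_def)
  moreover have "extend (\<lambda>_. 0) o' = (0 :: 'k)" for o' by (cases o') simp_all
  then have "operate h (\<lambda>_. 0) st = 0" for st by (simp add: operate_def)
  ultimately show "h * f \<in> annihilator" by (simp add: annihilator_def operate_mult)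
qed

lemma relations_annihilator:
  "(nil_relations \<rho> \<Delta> :: ('x, 'i, 'k::{comm_ring, comm_monoid_mult}) nil_free set) \<subseteq> annihilator"
proof
  fix f :: "('x, 'i, 'k) nil_free"
  assume "f \<in> nil_relations \<rho> \<Delta>"
  then consider
      x y where "f = free_e x * free_e y - (if x = y then free_e x else 0)"
    | "f = (\<Sum>x\<in>UNIV. free_e x) - free_const 1"
    | x i where "f = free_n x i * free_e (\<rho> i x) - free_n x i"
    | x i where "f = free_e x * free_n x i - free_n x i"
    | x i where "f = free_n (\<rho> i x) i * free_n x i"
    | x i j m where "f = free_n_prod \<rho> x (alternating i j m) - free_n_prod \<rho> x (alternating j i m)"
        "i \<noteq> j" "coxeter_number \<Delta> x i j = enat m"
    unfolding nil_relations_def by blast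
  then have "operate f \<phi> (z, g) = 0" if g: "good g z" for \<phi> z g
  proof cases
    case (5 x i)
    \<comment> \<open>One step with \<open>i\<close> turns the sign of \<open>simple_root i\<close>,
      which blocks the second step.\<close>
    have "\<not> nonneg (- g (simple_root i))" if "nonneg (g (simple_root i))"
      using good_not_both[OF g simple_root_in] that by blast
    then show ?thesis
      using int_linear_uminus[OF good_linear[OF g]] by (simp add: 5 operate_mult operate_n)
  next
    case (6 x i j m)
    have c: "coxeter_number \<Delta> x j i = enat m" using 6(3) coxeter_sym by metis
    have m: "alternating i j m \<noteq> []" "alternating j i m \<noteq> []"
      using coxeter_pos[OF 6(2,3)] by (metis length_alternating less_irrefl list.size(3))+
    show ?thesis
    proof (cases "z = x")
      case True
      \<comment> \<open>Both words are blocked under the same condition and otherwise lead to the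
        same state.\<close>
      have "red g x (alternating i j m) \<longleftrightarrow> red g x (alternating j i m)"
        using red_alternating_iff[OF 6(2,3)] red_alternating_iff[OF 6(2)[symmetric] c] g True by blast
      then show ?thesis
        unfolding 6(1) True operate_diff operate_n_prod src_alternating(2)[OF 6(2,3)] act_alternating[OF 6(2,3)]
        by simp
    next
      case False
      then show ?thesis using m by (simp add: 6(1) operate_diff operate_n_prod_off)
    qed
  qed (simp_all add: operate_diff operate_mult operate_e operate_n operate_sum operate_const)
  then show "f \<in> annihilator" by (simp add: annihilator_def)
qed

end

section \<open>The nil-Hecke algebra as a quotient\<close>

lemma free_algebra_simps [simp]:
  "carrier free_algebra = UNIV" "f \<otimes>\<^bsub>free_algebra\<^esub> g = f * g" "f \<oplus>\<^bsub>free_algebra\<^esub> g = f + g"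
  "\<one>\<^bsub>free_algebra\<^esub> = free_const 1" "\<zero>\<^bsub>free_algebra\<^esub> = 0"
  by (simp_all add: free_algebra_def)

lemma free_algebra_ring: "ring (free_algebra :: ('x, 'i, 'k::{comm_ring, comm_monoid_mult}) nil_free ring)"
proof (rule ringI)
  show "abelian_group (free_algebra :: ('x, 'i, 'k) nil_free ring)"
  proof (rule abelian_groupI)
    fix f :: "('x, 'i, 'k) nil_free"
    show "\<exists>g\<in>carrier free_algebra. g \<oplus>\<^bsub>free_algebra\<^esub> f = \<zero>\<^bsub>free_algebra\<^esub>"
      by (rule bexI[of _ "- f"]) simp_all
  qed (simp_all add: add.assoc add.commute)
  show "Group.monoid (free_algebra :: ('x, 'i, 'k) nil_free ring)"
    by (rule monoidI) (simp_all add: mult.assoc)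
qed (simp_all add: distrib_left distrib_right)

lemma free_algebra_uminus [simp]:
  fixes f :: "('x, 'i, 'k::{comm_ring, comm_monoid_mult}) nil_free"
  shows "\<ominus>\<^bsub>free_algebra\<^esub> f = - f"
proof -
  interpret ring "free_algebra :: ('x, 'i, 'k) nil_free ring"
    by (rule free_algebra_ring)
  show ?thesis using minus_equality[of "- f" f] by simp
qed

lemma free_algebra_minus [simp]: "f \<ominus>\<^bsub>free_algebra\<^esub> g = f - g"
  by (simp add: a_minus_def)

context finite_root_system
begin

lemma nil_ideal_ideal: "ideal (nil_ideal \<rho> \<Delta>) free_algebra"
  unfolding nil_ideal_def by (rule ring.genideal_ideal[OF free_algebra_ring]) simp

section \<open>Calculation modulo the relations\<close>

definition cong (infix "\<approx>" 50) where "f \<approx> g \<longleftrightarrow> f - g \<in> nil_ideal \<rho> \<Delta>"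

lemma nil_coset_eq_iff: "nil_coset \<rho> \<Delta> f = nil_coset \<rho> \<Delta> g \<longleftrightarrow> f \<approx> g"
  unfolding nil_coset_def cong_def
  using ring.quotient_eq_iff_same_a_r_cos[OF free_algebra_ring nil_ideal_ideal, of f g] by simp

lemma cong_refl [simp]: "f \<approx> f"
  by (simp add: nil_coset_eq_iff[symmetric])

lemma cong_sym: "f \<approx> g \<Longrightarrow> g \<approx> f"
  by (simp add: nil_coset_eq_iff[symmetric])

lemma cong_trans [trans]: "f \<approx> g \<Longrightarrow> g \<approx> h \<Longrightarrow> f \<approx> h"
  by (simp add: nil_coset_eq_iff[symmetric])

lemma nil_ideal_add: "f \<in> nil_ideal \<rho> \<Delta> \<Longrightarrow> g \<in> nil_ideal \<rho> \<Delta> \<Longrightarrow> f + g \<in> nil_ideal \<rho> \<Delta>"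
  using additive_subgroup.a_closed[OF ideal.axioms(1)[OF nil_ideal_ideal]] by simp

lemma cong_add: "f \<approx> f' \<Longrightarrow> g \<approx> g' \<Longrightarrow> f + g \<approx> f' + g'"
  using nil_ideal_add[of "f - f'" "g - g'"] by (simp add: cong_def algebra_simps)

lemma cong_mult_left: "f \<approx> f' \<Longrightarrow> h * f \<approx> h * f'"
  using ideal.I_l_closed[OF nil_ideal_ideal, of "f - f'" h] by (simp add: cong_def right_diff_distrib)

lemma cong_mult_right: "f \<approx> f' \<Longrightarrow> f * h \<approx> f' * h"
  using ideal.I_r_closed[OF nil_ideal_ideal, of "f - f'" h] by (simp add: cong_def left_diff_distrib)

text \<open>The annihilator is an ideal containing the relations, hence the ideal they generate; so
  the operators on tested states are well defined on the quotient.\<close>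

lemma cong_annihilator:
  fixes f g :: "('x, 'i, 'k::{comm_ring, comm_monoid_mult}) nil_free"
  assumes "f \<approx> g" "good h z"
  shows "operate f \<phi> (z, h) = operate g \<phi> (z, h)"
proof -
  have "ideal annihilator (free_algebra :: ('x, 'i, 'k) nil_free ring)"
  proof (rule idealI[OF free_algebra_ring])
    let ?A = "annihilator :: ('x, 'i, 'k) nil_free set"
    have uminus: "inv\<^bsub>add_monoid free_algebra\<^esub> a = - a" for a :: "('x, 'i, 'k) nil_free"
      using free_algebra_uminus unfolding a_inv_def .
    have "0 \<in> ?A" by (simp add: annihilator_def)
    moreover have "- a \<in> ?A" "a + b \<in> ?A" if "a \<in> ?A" "b \<in> ?A" for a b
      using that by (simp_all add: annihilator_def operate_uminus operate_add)
    ultimately show "subgroup ?A (add_monoid free_algebra)"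
      by (intro group.subgroupI abelian_group.a_group ring.is_abelian_group free_algebra_ring)
         (auto simp: uminus[simplified])
  qed (simp_all add: annihilator_mult)
  then have "nil_ideal \<rho> \<Delta> \<subseteq> (annihilator :: ('x, 'i, 'k) nil_free set)"
    unfolding nil_ideal_def
    by (rule ring.genideal_minimal[OF free_algebra_ring]) (rule relations_annihilator)
  then have "operate (f - g) \<phi> (z, h) = 0"
    using assms by (auto simp: cong_def annihilator_def)
  then show ?thesis by (simp add: operate_diff)
qed

lemma relation_cong: "f - g \<in> nil_relations \<rho> \<Delta> \<Longrightarrow> f \<approx> g"
  unfolding cong_def nil_ideal_def
  by (rule subsetD[OF ring.genideal_self[OF free_algebra_ring]]) simp_all

lemma e_e: "free_e x * free_e y \<approx> (if x = y then free_e x else 0)"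
  by (rule relation_cong) (unfold nil_relations_def, blast)

lemma sum_e: "(\<Sum>x\<in>UNIV. free_e x) \<approx> free_const 1"
  by (rule relation_cong) (unfold nil_relations_def, blast)

lemma n_e: "free_n x i * free_e (\<rho> i x) \<approx> free_n x i"
  by (rule relation_cong) (unfold nil_relations_def, blast)

lemma e_n: "free_e x * free_n x i \<approx> free_n x i"
  by (rule relation_cong) (unfold nil_relations_def, blast)

lemma n_n: "free_n x i * free_n (\<rho> i x) i \<approx> 0"
proof (rule relation_cong)
  have "free_n (\<rho> i (\<rho> i x)) i * free_n (\<rho> i x) i \<in> nil_relations \<rho> \<Delta>"
    unfolding nil_relations_def by blast
  then show "free_n x i * free_n (\<rho> i x) i - 0 \<in> nil_relations \<rho> \<Delta>" by simp
qed

lemma n_alternating: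
  "i \<noteq> j \<Longrightarrow> coxeter_number \<Delta> x i j = enat m \<Longrightarrow>
    free_n_prod \<rho> x (alternating i j m) \<approx> free_n_prod \<rho> x (alternating j i m)"
  by (rule relation_cong) (unfold nil_relations_def, blast)

lemma free_n_prod_append: "free_n_prod \<rho> x (u @ v) = free_n_prod \<rho> x u * free_n_prod \<rho> (src \<rho> x u) v"
  by (induction u arbitrary: x) (simp_all add: mult.assoc)

lemma braid_free_n_prod: "braid x u v \<Longrightarrow> free_n_prod \<rho> x u \<approx> free_n_prod \<rho> x v"
proof (induction rule: braid.induct)
  case (braid_step i j x p m q v)
  have "free_n_prod \<rho> x (p @ alternating i j m @ q) \<approx> free_n_prod \<rho> x (p @ alternating j i m @ q)"
    unfolding free_n_prod_append src_alternating(2)[OF braid_step(1,2)]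
    by (intro cong_mult_left cong_mult_right n_alternating[OF braid_step(1,2)])
  then show ?case using braid_step.IH by (rule cong_trans)
qed simp

text \<open>Braid moves produce a factor \<open>[k, k]\<close>, which the nil relation
  kills.\<close>

lemma not_red_free_n_prod:
  assumes "\<not> red id x u" shows "free_n_prod \<rho> x u \<approx> 0"
proof -
  obtain p k q where b: "braid x u (p @ [k, k] @ q)" using not_red_braid[OF assms] by blast
  let ?y = "src \<rho> x p"
  have "free_n_prod \<rho> x p * ((free_n ?y k * free_n (\<rho> k ?y) k) * free_n_prod \<rho> ?y q)
      \<approx> free_n_prod \<rho> x p * (0 * free_n_prod \<rho> ?y q)"
    by (intro cong_mult_left cong_mult_right n_n)
  then have "free_n_prod \<rho> x (p @ [k, k] @ q) \<approx> 0"
    by (simp add: free_n_prod_append mult.assoc)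
  with braid_free_n_prod[OF b] show ?thesis by (rule cong_trans)
qed

text \<open>The leading idempotent makes the empty word give the idempotent at \<open>x\<close>
  instead of 1, and nonempty words absorb it; this treats identities and other morphisms
  alike.\<close>

definition monomial :: "'x \<Rightarrow> 'i list \<Rightarrow> ('x, 'i, 'k::{comm_ring, comm_monoid_mult}) nil_free" where
  "monomial x u = free_e x * free_n_prod \<rho> x u"

lemma operate_monomial:
  "operate (monomial x u) \<phi> (z, g) =
     (if z = x \<and> red g x u then \<phi> (src \<rho> x u, g \<circ> act x u) else 0)"
  by (simp add: monomial_def operate_mult operate_e operate_n_prod)

lemma monomial_Nil: "monomial x [] = free_e x"
  by (simp add: monomial_def)

lemma monomial_Cons: "monomial x (i # u) \<approx> free_n x i * free_n_prod \<rho> (\<rho> i x) u"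
  using cong_mult_right[OF e_n] by (simp add: monomial_def mult.assoc[symmetric])

lemma monomial_cong: "u \<noteq> [] \<Longrightarrow> monomial x u \<approx> free_n_prod \<rho> x u"
  using monomial_Cons by (cases u) simp_all

lemma e_monomial: "free_e y * monomial x u \<approx> (if x = y then monomial x u else 0)"
  using cong_mult_right[OF e_e[of y x], of "free_n_prod \<rho> x u"]
  by (simp add: monomial_def mult.assoc split: if_splits)

lemma n_monomial: "free_n y i * monomial x u \<approx> (if x = \<rho> i y then monomial y (i # u) else 0)"
proof (cases "x = \<rho> i y")
  case True
  have "free_n y i * monomial x u \<approx> free_n y i * free_n_prod \<rho> (\<rho> i y) u"
    using cong_mult_right[OF n_e] by (simp add: True monomial_def mult.assoc[symmetric])
  from cong_trans[OF this cong_sym[OF monomial_Cons]] show ?thesis using True by simp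
next
  case False
  \<comment> \<open>Inserting the idempotent at \<open>\<rho> i y\<close> brings it next to the one
    at \<open>x\<close>, and the two are orthogonal.\<close>
  have "free_n y i * monomial x u \<approx> free_n y i * free_e (\<rho> i y) * monomial x u"
    by (rule cong_mult_right[OF cong_sym[OF n_e]])
  also have "\<dots> \<approx> 0"
    using cong_mult_left[OF e_monomial[of "\<rho> i y" x u], of "free_n y i"] False
    by (simp add: mult.assoc)
  finally show ?thesis using False by simp
qed

lemma gen_monomial:
  "(\<exists>y v. free_gen a * (monomial x u :: ('x, 'i, 'k::{comm_ring, comm_monoid_mult}) nil_free) \<approx> monomial y v) \<or>
    free_gen a * (monomial x u :: ('x, 'i, 'k) nil_free) \<approx> 0"
proof (cases a)
  case (Gen_e z)
  have "free_gen a * (monomial x u :: ('x, 'i, 'k) nil_free) \<approx> (if x = z then monomial x u else 0)"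
    unfolding Gen_e free_gen_simps(1)[symmetric] by (rule e_monomial)
  then show ?thesis by (cases "x = z") auto
next
  case (Gen_n z i)
  have "free_gen a * (monomial x u :: ('x, 'i, 'k) nil_free) \<approx> (if x = \<rho> i z then monomial z (i # u) else 0)"
    unfolding Gen_n free_gen_simps(2)[symmetric] by (rule n_monomial)
  then show ?thesis by (cases "x = \<rho> i z") auto
qed

lemma nil_coset_monomial:
  "nil_coset \<rho> \<Delta> (monomial x u) = (if u = [] then nil_e \<rho> \<Delta> x else nil_coset \<rho> \<Delta> (free_n_prod \<rho> x u))"
  by (simp add: nil_e_def monomial_Nil nil_coset_eq_iff monomial_cong)

end

section \<open>The basis\<close>

context finite_root_system
begin

section \<open>Operations of the quotient on cosets\<close>

lemma nil_Hecke_carrier: "carrier (nil_Hecke \<rho> \<Delta>) = range (nil_coset \<rho> \<Delta>)"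
proof -
  have "carrier (nil_Hecke \<rho> \<Delta>) = a_rcosets\<^bsub>free_algebra\<^esub> (nil_ideal \<rho> \<Delta>)"
    by (simp add: nil_Hecke_def Let_def FactRing_def)
  then show ?thesis by (auto simp: A_RCOSETS_def' nil_coset_def)
qed

lemma nil_Hecke_mult:
  "nil_coset \<rho> \<Delta> f \<otimes>\<^bsub>nil_Hecke \<rho> \<Delta>\<^esub> nil_coset \<rho> \<Delta> g = nil_coset \<rho> \<Delta> (f * g)"
  using ideal.rcoset_mult_add[OF nil_ideal_ideal, of f g]
  by (simp add: nil_Hecke_def Let_def FactRing_def nil_coset_def)

lemma nil_Hecke_add:
  "nil_coset \<rho> \<Delta> f \<oplus>\<^bsub>nil_Hecke \<rho> \<Delta>\<^esub> nil_coset \<rho> \<Delta> g = nil_coset \<rho> \<Delta> (f + g)"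
  using ideal.a_rcos_sum[OF nil_ideal_ideal, of f g]
  by (simp add: nil_Hecke_def Let_def FactRing_def nil_coset_def)

lemma nil_Hecke_smult:
  "a \<odot>\<^bsub>nil_Hecke \<rho> \<Delta>\<^esub> nil_coset \<rho> \<Delta> f = nil_coset \<rho> \<Delta> (free_const a * f)"
  using ideal.rcoset_mult_add[OF nil_ideal_ideal, of "free_const a" f]
  by (simp add: nil_Hecke_def Let_def FactRing_def nil_coset_def)

lemma nil_Hecke_one: "\<one>\<^bsub>nil_Hecke \<rho> \<Delta>\<^esub> = nil_coset \<rho> \<Delta> (free_const 1)"
  by (simp add: nil_Hecke_def Let_def FactRing_def nil_coset_def)

lemma nil_ideal_zero: "0 \<in> nil_ideal \<rho> \<Delta>"
  using additive_subgroup.zero_closed[OF ideal.axioms(1)[OF nil_ideal_ideal]] by simp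

lemma nil_Hecke_zero: "\<zero>\<^bsub>nil_Hecke \<rho> \<Delta>\<^esub> = nil_coset \<rho> \<Delta> 0"
  unfolding nil_Hecke_def Let_def FactRing_def nil_coset_def
  using ring.a_rcos_zero[OF free_algebra_ring nil_ideal_ideal nil_ideal_zero, symmetric] by simp

lemma nil_Hecke_abelian_monoid: "abelian_monoid (nil_Hecke \<rho> \<Delta>)"
  by (rule abelian_monoidI)
     (auto simp: nil_Hecke_carrier nil_Hecke_add nil_Hecke_zero ac_simps)

lemma finsum_nil_coset:
  assumes "finite A" "\<And>w. w \<in> A \<Longrightarrow> F w = nil_coset \<rho> \<Delta> (h w)"
  shows "(\<Oplus>\<^bsub>nil_Hecke \<rho> \<Delta>\<^esub>w\<in>A. F w) = nil_coset \<rho> \<Delta> (\<Sum>w\<in>A. h w)"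
  using assms
proof (induction A)
  case empty
  show ?case
    using abelian_monoid.finsum_empty[OF nil_Hecke_abelian_monoid, of F] by (simp add: nil_Hecke_zero)
next
  case (insert w A)
  have "F \<in> A \<rightarrow> carrier (nil_Hecke \<rho> \<Delta>)" "F w \<in> carrier (nil_Hecke \<rho> \<Delta>)"
    using insert.prems by (auto simp: nil_Hecke_carrier)
  then show ?case
    using abelian_monoid.finsum_insert[OF nil_Hecke_abelian_monoid insert.hyps, of F] insert
    by (simp add: nil_Hecke_add)
qed

lemma nil_prod_coset: "nil_prod \<rho> \<Delta> x u = nil_coset \<rho> \<Delta> (free_n_prod \<rho> x u)"
  by (induction u arbitrary: x) (simp_all add: nil_Hecke_one nil_n_def nil_Hecke_mult)

lemma braid_monomial: "braid x u v \<Longrightarrow> monomial x u \<approx> monomial x v"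
  unfolding monomial_def by (rule cong_mult_left[OF braid_free_n_prod])

text \<open>The case distinction in \<open>nil_T\<close> is the class of a monomial, and reduced
  expressions of \<open>w\<close> differ by braid moves only.\<close>

lemma nil_T_reduced:
  assumes "reduced_expression \<rho> \<Delta> x u w"
  shows "nil_T \<rho> \<Delta> w = nil_coset \<rho> \<Delta> (monomial x u)"
  unfolding nil_T_def nil_prod_coset nil_coset_monomial[symmetric]
proof (rule the_equality)
  show "t = nil_coset \<rho> \<Delta> (monomial x u)"
    if ex: "\<exists>y v. reduced_expression \<rho> \<Delta> y v w \<and> t = nil_coset \<rho> \<Delta> (monomial y v)" for t
  proof -
    obtain y v where v: "reduced_expression \<rho> \<Delta> y v w" and t: "t = nil_coset \<rho> \<Delta> (monomial y v)"
      using ex by blast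
    have "x = y" and b: "braid x u v" using reduced_expressions_braid[OF assms v] by auto
    show ?thesis
      unfolding t \<open>x = y\<close>[symmetric] nil_coset_eq_iff by (rule cong_sym[OF braid_monomial[OF b]])
  qed
qed (use assms in blast)

text \<open>With \<open>rep_word\<close>, this picks an arbitrary reduced expression of
  \<open>w\<close>, used to lift \<open>nil_T\<close> to the free algebra.\<close>

definition rep_target :: "('x, 'i) weyl_morphism \<Rightarrow> 'x" where
  "rep_target w = fst (SOME p. reduced_expression \<rho> \<Delta> (fst p) (snd p) w)"

definition rep_word :: "('x, 'i) weyl_morphism \<Rightarrow> 'i list" where
  "rep_word w = snd (SOME p. reduced_expression \<rho> \<Delta> (fst p) (snd p) w)"

lemma rep_reduced:
  "w \<in> weyl_morphisms \<rho> \<Delta> \<Longrightarrow> reduced_expression \<rho> \<Delta> (rep_target w) (rep_word w) w"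
  using someI_ex[of "\<lambda>p. reduced_expression \<rho> \<Delta> (fst p) (snd p) w"]
  unfolding weyl_morphisms_reduced rep_target_def rep_word_def by simp

definition rep :: "('x, 'i) weyl_morphism \<Rightarrow> ('x, 'i, 'k::{comm_ring, comm_monoid_mult}) nil_free" where
  "rep w = monomial (rep_target w) (rep_word w)"

lemma nil_T_rep: "w \<in> weyl_morphisms \<rho> \<Delta> \<Longrightarrow> nil_T \<rho> \<Delta> w = nil_coset \<rho> \<Delta> (rep w)"
  unfolding rep_def by (rule nil_T_reduced[OF rep_reduced])

lemma monomial_rep:
  assumes "red id x u"
  shows "sigma_prod \<rho> \<Delta> x u \<in> weyl_morphisms \<rho> \<Delta> \<and> monomial x u \<approx> rep (sigma_prod \<rho> \<Delta> x u)"
proof -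
  have r: "reduced_expression \<rho> \<Delta> x u (sigma_prod \<rho> \<Delta> x u)"
    using assms by (simp add: reduced_expression_iff)
  then have w: "sigma_prod \<rho> \<Delta> x u \<in> weyl_morphisms \<rho> \<Delta>" unfolding weyl_morphisms_reduced by blast
  show ?thesis
    using w reduced_expressions_braid[OF r rep_reduced[OF w]] braid_monomial by (auto simp: rep_def)
qed

definition combination ::
  "(('x, 'i) weyl_morphism \<Rightarrow>\<^sub>0 'k) \<Rightarrow> ('x, 'i, 'k::{comm_ring, comm_monoid_mult}) nil_free" where
  "combination a = (\<Sum>w\<in>Poly_Mapping.keys a. free_const (Poly_Mapping.lookup a w) * rep w)"

lemma combination_add: "combination (a + b) = combination a + combination b"
  unfolding combination_def
  by (rule setsum_keys_plus_distrib) (simp_all add: free_const_add distrib_right)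

lemma combination_single: "combination (Poly_Mapping.single w c) = free_const c * rep w"
  by (simp add: combination_def)

lemma family_combination_nil_T:
  assumes "Poly_Mapping.keys a \<subseteq> weyl_morphisms \<rho> \<Delta>"
  shows "family_combination (nil_Hecke \<rho> \<Delta>) (nil_T \<rho> \<Delta>) a = nil_coset \<rho> \<Delta> (combination a)"
  unfolding family_combination_def combination_def
  using assms by (intro finsum_nil_coset) (auto simp: nil_T_rep nil_Hecke_smult subset_iff)

section \<open>Spanning and linear independence\<close>

definition spanned :: "('x, 'i, 'k::{comm_ring, comm_monoid_mult}) nil_free \<Rightarrow> bool" where
  "spanned f \<longleftrightarrow> (\<exists>a. Poly_Mapping.keys a \<subseteq> weyl_morphisms \<rho> \<Delta> \<and> f \<approx> combination a)"

lemma spanned_cong: "f \<approx> g \<Longrightarrow> spanned g \<Longrightarrow> spanned f"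
  unfolding spanned_def using cong_trans by blast

lemma spanned_0: "spanned 0"
  unfolding spanned_def by (rule exI[of _ 0]) (simp add: combination_def)

lemma spanned_add: "spanned f \<Longrightarrow> spanned g \<Longrightarrow> spanned (f + g)"
  unfolding spanned_def
  by (metis (no_types, opaque_lifting) combination_add cong_add keys_add le_sup_iff subset_trans)

lemma spanned_sum: "(\<And>a. a \<in> A \<Longrightarrow> spanned (f a)) \<Longrightarrow> spanned (sum f A)"
  by (induction A rule: infinite_finite_induct) (simp_all add: spanned_0 spanned_add)

lemma spanned_monomial: "spanned (free_const c * monomial x u)"
proof (cases "red id x u")
  case True
  have "free_const c * monomial x u \<approx> combination (Poly_Mapping.single (sigma_prod \<rho> \<Delta> x u) c)"
    unfolding combination_single by (intro cong_mult_left conjunct2[OF monomial_rep[OF True]])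
  moreover have "Poly_Mapping.keys (Poly_Mapping.single (sigma_prod \<rho> \<Delta> x u) c) \<subseteq> weyl_morphisms \<rho> \<Delta>"
    using conjunct1[OF monomial_rep[OF True]] by simp
  ultimately show ?thesis unfolding spanned_def by blast
next
  case False
  have "free_const c * monomial x u \<approx> free_const c * (free_e x * 0)"
    unfolding monomial_def by (intro cong_mult_left not_red_free_n_prod False)
  then show ?thesis using spanned_cong spanned_0 by simp
qed

text \<open>Scalars commute with generators, and a generator times a monomial is congruent to a
  monomial or to 0.\<close>

lemma spanned_gen:
  fixes f :: "('x, 'i, 'k::{comm_ring, comm_monoid_mult}) nil_free"
  assumes "spanned f" shows "spanned (free_gen a * f)"
proof -
  obtain b where b: "f \<approx> combination b" using assms unfolding spanned_def by blast
  have "free_gen a * combination b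
      = (\<Sum>w\<in>Poly_Mapping.keys b. free_const (Poly_Mapping.lookup b w) * (free_gen a * rep w))"
    unfolding combination_def sum_distrib_left
    by (rule sum.cong) (simp_all add: mult.assoc[symmetric] free_const_commute[of _ "free_gen a"])
  moreover have "spanned (free_const c * (free_gen a * rep w))" for c :: 'k and w
    unfolding rep_def
    using gen_monomial[where ?'k = 'k, of a "rep_target w" "rep_word w"]
  proof (elim disjE exE)
    fix y v
    assume *: "free_gen a * (monomial (rep_target w) (rep_word w) :: ('x, 'i, 'k) nil_free) \<approx> monomial y v"
    show "spanned (free_const c * (free_gen a * monomial (rep_target w) (rep_word w)))"
      by (rule spanned_cong[OF cong_mult_left[OF *] spanned_monomial])
  next
    assume *: "free_gen a * (monomial (rep_target w) (rep_word w) :: ('x, 'i, 'k) nil_free) \<approx> 0"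
    show "spanned (free_const c * (free_gen a * monomial (rep_target w) (rep_word w)))"
      by (rule spanned_cong[OF cong_mult_left[OF *]]) (simp add: spanned_0)
  qed
  ultimately have "spanned (free_gen a * combination b)" by (simp add: spanned_sum)
  then show ?thesis by (rule spanned_cong[OF cong_mult_left[OF b]])
qed

text \<open>The span contains 1, the sum of the idempotents, and is stable under left multiplication
  by generators, so it contains all words.\<close>

lemma spanned_all: "spanned f"
proof (induction f rule: poly_mapping_additive_induct)
  case (single u c)
  have "spanned (Poly_Mapping.single (FMon l) c)" for l
  proof (induction l)
    case Nil
    have "free_const c * free_const 1 \<approx> free_const c * (\<Sum>x\<in>UNIV. free_e x)"
      by (intro cong_mult_left cong_sym[OF sum_e])
    moreover have "spanned (free_const c * (\<Sum>x\<in>UNIV. free_e x))"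
      unfolding sum_distrib_left monomial_Nil[symmetric] by (intro spanned_sum spanned_monomial)
    ultimately have "spanned (free_const c)" using spanned_cong by fastforce
    then show ?case by (simp add: free_const_def zero_fmon_def)
  next
    case (Cons a l)
    then show ?case unfolding single_Cons by (rule spanned_gen)
  qed
  from this[of "fmon_list u"] show ?case by simp
qed (rule spanned_add)

text \<open>Applied to the indicator function of the state reached by the word of \<open>w0\<close>
  and evaluated at \<open>(x0, id)\<close>, the combination returns the coefficient of
  \<open>w0\<close>.\<close>

lemma combination_independent:
  fixes a :: "('x, 'i) weyl_morphism \<Rightarrow>\<^sub>0 'k::{comm_ring, comm_monoid_mult}"
  assumes "Poly_Mapping.keys a \<subseteq> weyl_morphisms \<rho> \<Delta>" "combination a \<approx> 0"
  shows "a = 0"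
proof (rule poly_mapping_eqI)
  fix w0
  show "Poly_Mapping.lookup a w0 = Poly_Mapping.lookup 0 w0"
  proof (cases "w0 \<in> Poly_Mapping.keys a")
    case True
    define x0 u0 where "x0 = rep_target w0" and "u0 = rep_word w0"
    define \<phi> :: "('x, 'i) state \<Rightarrow> 'k" where
      "\<phi> t = (if t = (src \<rho> x0 u0, act x0 u0) then 1 else 0)" for t
    have r0: "red id x0 u0" "w0 = sigma_prod \<rho> \<Delta> x0 u0"
      using rep_reduced[of w0] assms(1) True unfolding reduced_expression_iff x0_def u0_def by auto
    have op: "operate (rep w) \<phi> (x0, id) = (if w = w0 then 1 else 0)" if "w \<in> Poly_Mapping.keys a" for w
    proof -
      have r: "red id (rep_target w) (rep_word w)" "w = sigma_prod \<rho> \<Delta> (rep_target w) (rep_word w)"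
        using rep_reduced[of w] assms(1) that unfolding reduced_expression_iff by auto
      \<comment> \<open>Monomials with another target vanish at this state; among the others, equal
        source and action force equality up to braid moves, hence the same morphism.\<close>
      have "w = w0" if "rep_target w = x0" "src \<rho> x0 (rep_word w) = src \<rho> x0 u0"
        "act x0 (rep_word w) = act x0 u0"
        using matsumoto[OF _ r0(1) that(2,3)] r r0 braid_sigma_prod that(1) by metis
      then show ?thesis
        unfolding rep_def operate_monomial \<phi>_def using r(1) r0(1)
        by (auto simp: x0_def u0_def)
    qed
    have "0 = operate (combination a) \<phi> (x0, id)"
      using cong_annihilator[OF assms(2) good_id] by simp
    also have "\<dots> = (\<Sum>w\<in>Poly_Mapping.keys a. Poly_Mapping.lookup a w * operate (rep w) \<phi> (x0, id))"
      by (simp add: combination_def operate_sum operate_mult operate_const)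
    also have "\<dots> = (\<Sum>w\<in>Poly_Mapping.keys a. if w = w0 then Poly_Mapping.lookup a w else 0)"
      by (rule sum.cong) (simp_all add: op)
    also have "\<dots> = Poly_Mapping.lookup a w0" using True by simp
    finally show ?thesis by simp
  qed (simp add: in_keys_iff)
qed

lemma nil_T_basis: "family_basis (nil_Hecke \<rho> \<Delta>) (weyl_morphisms \<rho> \<Delta>) (nil_T \<rho> \<Delta>)"
  unfolding family_basis_def
proof (intro conjI ballI allI impI)
  show "nil_T \<rho> \<Delta> ` weyl_morphisms \<rho> \<Delta> \<subseteq> carrier (nil_Hecke \<rho> \<Delta>)"
    by (auto simp: nil_T_rep nil_Hecke_carrier)
next
  fix v assume "v \<in> carrier (nil_Hecke \<rho> \<Delta>)"
  then obtain f where f: "v = nil_coset \<rho> \<Delta> f" by (auto simp: nil_Hecke_carrier)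
  obtain a where a: "Poly_Mapping.keys a \<subseteq> weyl_morphisms \<rho> \<Delta>" "f \<approx> combination a"
    using spanned_all unfolding spanned_def by blast
  then have "v = family_combination (nil_Hecke \<rho> \<Delta>) (nil_T \<rho> \<Delta>) a"
    by (simp add: f family_combination_nil_T nil_coset_eq_iff)
  with a(1) show "\<exists>a. Poly_Mapping.keys a \<subseteq> weyl_morphisms \<rho> \<Delta> \<and>
      v = family_combination (nil_Hecke \<rho> \<Delta>) (nil_T \<rho> \<Delta>) a" by blast
next
  fix a assume "Poly_Mapping.keys a \<subseteq> weyl_morphisms \<rho> \<Delta>"
    "family_combination (nil_Hecke \<rho> \<Delta>) (nil_T \<rho> \<Delta>) a = \<zero>\<^bsub>nil_Hecke \<rho> \<Delta>\<^esub>"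
  then show "a = 0"
    by (intro combination_independent)
       (simp_all add: family_combination_nil_T nil_Hecke_zero nil_coset_eq_iff)
qed

lemma nil_prod_reduced_unique:
  "reduced_expression \<rho> \<Delta> x u w \<Longrightarrow> reduced_expression \<rho> \<Delta> x v w \<Longrightarrow>
    nil_prod \<rho> \<Delta> x u = nil_prod \<rho> \<Delta> x v"
  unfolding nil_prod_coset nil_coset_eq_iff
  by (rule braid_free_n_prod[OF conjunct2[OF reduced_expressions_braid]])

end

theorem theorem4p4:
  fixes \<rho> :: "'i::finite \<Rightarrow> 'x::finite \<Rightarrow> 'x"
    and C :: "'x \<Rightarrow> int ^ 'i ^ 'i"
    and \<Delta> :: "'x \<Rightarrow> (int ^ 'i) set"
  assumes "semi_Cartan_graph \<rho> C"
    and "generalized_root_system \<rho> C \<Delta>"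
  shows "(\<forall>x y. \<forall>w \<in> weyl_hom \<rho> \<Delta> y x. \<forall>is js.
            reduced_expression \<rho> \<Delta> x is w \<longrightarrow> reduced_expression \<rho> \<Delta> x js w \<longrightarrow>
            (nil_prod \<rho> \<Delta> x is :: ('x, 'i, 'k::{comm_ring, comm_monoid_mult}) nil_free set) = nil_prod \<rho> \<Delta> x js) \<and>
         family_basis
           (nil_Hecke \<rho> \<Delta> :: ('k, ('x, 'i, 'k) nil_free set) module)
           (weyl_morphisms \<rho> \<Delta>)
           (nil_T \<rho> \<Delta>)"
proof -
  interpret finite_root_system \<rho> C \<Delta>
    by unfold_locales (rule assms)+
  show ?thesis
    by (intro conjI allI ballI impI nil_T_basis) (rule nil_prod_reduced_unique)
qed

end
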